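(* The automorphism group $\mathrm{Aut}(F)$ of Thompson's group $F$ has a subgroup isomorphic to the additive group $\mathbb{Q}$ of rational numbers.
   Context: A dyadic rational is a rational number of the form $k/2^m$ with $k\in\mathbb{Z}$, $m\geq 0$. Thompson's group $F$ is the group (under composition) of all orientation-preserving piecewise-linear homeomorphisms of $[0,1]$ with finitely many breakpoints, such that every breakpoint has dyadic rational coordinates and the slope of each linear portion is an integer power of $2$. $\mathrm{Aut}(F)$ denotes the group of all group automorphisms of $F$. *)

theory Defs
  imports "HOL-Analysis.Analysis" "HOL-Algebra.Algebra"
begin

definition dyadic_rationals :: "real set" where
  "dyadic_rationals = {real_of_int k / 2 ^ m | (k::int) (m::nat). True}"

text \<open>The values of \<open>f\<close> outside \<open>[0,1]\<close> are irrelevant, and the end points of the interval do not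
  count as breakpoints.\<close>

definition breakpoints :: "(real \<Rightarrow> real) \<Rightarrow> real set" where
  "breakpoints f = {x \<in> {0<..<1}.
     \<not> (\<exists>e>0. \<exists>s c. \<forall>y\<in>{x - e<..<x + e} \<inter> {0..1}. f y = s * y + c)}"

text \<open>As in \<^const>\<open>Bij\<close>, maps of \<open>[0,1]\<close> are represented by their extensional
  representatives. The last condition says at once that \<open>f\<close> is linear between its breakpoints and
  that the slopes of the linear portions are integer powers of 2.\<close>

definition thompson_maps :: "(real \<Rightarrow> real) set" where
  "thompson_maps = {f \<in> extensional {0..1}.
     (\<exists>g. homeomorphism {0..1} {0..1} f g) \<and>
     strict_mono_on {0..1} f \<and>
     finite (breakpoints f) \<and>
     (\<forall>x\<in>breakpoints f. x \<in> dyadic_rationals \<and> f x \<in> dyadic_rationals) \<and>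
     (\<forall>a b. 0 \<le> a \<and> a < b \<and> b \<le> 1 \<and> {a<..<b} \<inter> breakpoints f = {} \<longrightarrow>
        (\<exists>(n::int) c. \<forall>x\<in>{a..b}. f x = 2 powi n * x + c))}"

definition thompson_F :: "(real \<Rightarrow> real) monoid" where
  "thompson_F = BijGroup {0..1} \<lparr>carrier := thompson_maps\<rparr>"

definition rat_group :: "rat monoid" where
  "rat_group = \<lparr>carrier = UNIV, monoid.mult = (+), one = 0\<rparr>"

lemma group_rat_group: "group rat_group"
  unfolding rat_group_def
proof (rule groupI; simp)
  show "\<And>x::rat. \<exists>y. y + x = 0"
    by (metis add.left_inverse)
qed

text \<open>It is enough to have a finite set of dyadic points containing all the breakpoints.\<close>

definition dyadic_linear_off :: "real set \<Rightarrow> (real \<Rightarrow> real) \<Rightarrow> bool" where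
  "dyadic_linear_off B f \<longleftrightarrow>
     (\<forall>a b. 0 \<le> a \<and> a < b \<and> b \<le> 1 \<and> {a<..<b} \<inter> B = {} \<longrightarrow>
        (\<exists>(n::int) c. \<forall>x\<in>{a..b}. f x = 2 powi n * x + c))"

lemma affine_unique:
  fixes s :: real
  assumes "u < v" "s * u + c = s' * u + c'" "s * v + c = s' * v + c'"
  shows "s = s'" "c = c'"
proof -
  have "(s - s') * (v - u) = 0"
    using assms(2,3) by (simp add: algebra_simps)
  then show "s = s'" using assms(1) by simp
  then show "c = c'" using assms(2) by simp
qed

lemma breakpoints_subset:
  assumes "finite B" "dyadic_linear_off B f"
  shows "breakpoints f \<subseteq> B"
proof
  fix x assume x: "x \<in> breakpoints f"
  show "x \<in> B"
  proof (rule ccontr)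
    assume "x \<notin> B"
    have "open ({0<..<1} - B)"
      using assms(1) by (simp add: finite_imp_closed open_Diff)
    moreover have "x \<in> {0<..<1} - B"
      using x \<open>x \<notin> B\<close> by (auto simp: breakpoints_def)
    ultimately obtain e where e: "e > 0" "cball x e \<subseteq> {0<..<1} - B"
      using open_contains_cball by blast
    then have sub: "{x - e..x + e} \<subseteq> {0<..<1} - B"
      by (simp add: cball_eq_atLeastAtMost)
    then have "x - e \<in> {0<..<1}" "x + e \<in> {0<..<1}"
      using e(1) subsetD[OF sub, of "x - e"] subsetD[OF sub, of "x + e"] by auto
    moreover have "{x - e<..<x + e} \<inter> B = {}"
      using sub by (auto simp: subset_iff)
    ultimately have "0 \<le> x - e \<and> x - e < x + e \<and> x + e \<le> 1 \<and> {x - e<..<x + e} \<inter> B = {}"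
      using e(1) by auto
    then obtain n :: int and c where "\<forall>y\<in>{x - e..x + e}. f y = 2 powi n * y + c"
      using assms(2) unfolding dyadic_linear_off_def by blast
    then have "\<exists>e>0. \<exists>s c. \<forall>y\<in>{x - e<..<x + e} \<inter> {0..1}. f y = s * y + c"
      using e(1) by (intro exI[of _ e] conjI exI[of _ "2 powi n"] exI[of _ c]) auto
    then show False using x unfolding breakpoints_def by blast
  qed
qed

lemma dyadic_linear_off_remove:
  assumes off: "dyadic_linear_off B f" and b: "b \<notin> breakpoints f"
  shows "dyadic_linear_off (B - {b}) f"
  unfolding dyadic_linear_off_def
proof (intro allI impI)
  fix u v :: real
  assume uv: "0 \<le> u \<and> u < v \<and> v \<le> 1 \<and> {u<..<v} \<inter> (B - {b}) = {}"
  show "\<exists>(n::int) c. \<forall>x\<in>{u..v}. f x = 2 powi n * x + c"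
  proof (cases "b \<in> {u<..<v}")
    case False
    then have "{u<..<v} \<inter> B = {u<..<v} \<inter> (B - {b})" by blast
    then have "{u<..<v} \<inter> B = {}" using uv by simp
    then show ?thesis using off uv unfolding dyadic_linear_off_def by blast
  next
    case True
    then have ub: "u < b" and bv: "b < v" by auto
    have "{u<..<b} \<inter> B \<subseteq> {u<..<v} \<inter> (B - {b})" "{b<..<v} \<inter> B \<subseteq> {u<..<v} \<inter> (B - {b})"
      using ub bv by auto
    then have "{u<..<b} \<inter> B = {}" "{b<..<v} \<inter> B = {}"
      using uv by auto
    moreover have "0 \<le> u" "b \<le> 1" "0 \<le> b" "v \<le> 1"
      using uv ub bv by auto
    ultimately obtain n c m d where
      l: "\<forall>x\<in>{u..b}. f x = 2 powi n * x + c" and r: "\<forall>x\<in>{b..v}. f x = 2 powi m * x + d"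
      using off ub bv unfolding dyadic_linear_off_def by meson
    have "b \<in> {0<..<1}" using uv ub bv by auto
    then obtain e s k where e: "e > 0" and
      loc: "\<forall>y\<in>{b - e<..<b + e} \<inter> {0..1}. f y = s * y + k"
      using b by (auto simp: breakpoints_def)
    define p where "p = max u (b - e/2)"
    define q where "q = min v (b + e/2)"
    have p: "p < b" "p \<in> {u..b}" "p \<in> {b - e<..<b + e} \<inter> {0..1}"
      using ub bv uv e by (auto simp: p_def)
    have q: "b < q" "q \<in> {b..v}" "q \<in> {b - e<..<b + e} \<inter> {0..1}"
      using ub bv uv e by (auto simp: q_def)
    have bb: "b \<in> {b - e<..<b + e} \<inter> {0..1}" "b \<in> {u..b}" "b \<in> {b..v}"
      using ub bv uv e by auto
    have "f p = 2 powi n * p + c" "f b = 2 powi n * b + c" using l p(2) bb(2) by blast+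
    moreover have "f p = s * p + k" "f b = s * b + k" using loc p(3) bb(1) by blast+
    ultimately have nc: "2 powi n = s" "c = k"
      using affine_unique[of p b "2 powi n" c s k] p(1) by auto
    have "f b = 2 powi m * b + d" "f q = 2 powi m * q + d" using r q(2) bb(3) by blast+
    moreover have "f b = s * b + k" "f q = s * q + k" using loc q(3) bb(1) by blast+
    ultimately have "2 powi m = s" "d = k"
      using affine_unique[of b q "2 powi m" d s k] q(1) by auto
    then have eq: "2 powi m = (2::real) powi n" "d = c" using nc by auto
    have "\<forall>x\<in>{u..v}. f x = 2 powi n * x + c"
    proof
      fix x assume "x \<in> {u..v}"
      then have "x \<in> {u..b} \<or> x \<in> {b..v}" by auto
      then show "f x = 2 powi n * x + c" using l r eq by metis
    qed
    then show ?thesis by blast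
  qed
qed

lemma dyadic_linear_off_breakpoints:
  assumes "finite B" "dyadic_linear_off B f"
  shows "dyadic_linear_off (breakpoints f) f"
proof -
  have "dyadic_linear_off (B - C) f" if "finite C" "C \<inter> breakpoints f = {}" for C
    using that
  proof (induction C rule: finite_induct)
    case empty
    then show ?case using assms by simp
  next
    case (insert b C)
    then have "dyadic_linear_off (B - C - {b}) f"
      by (intro dyadic_linear_off_remove) auto
    moreover have "B - insert b C = B - C - {b}" by auto
    ultimately show ?case by simp
  qed
  from this[of "B - breakpoints f"] have "dyadic_linear_off (B - (B - breakpoints f)) f"
    using assms(1) by auto
  moreover have "B - (B - breakpoints f) = breakpoints f"
    using breakpoints_subset[OF assms] by auto
  ultimately show ?thesis by simp
qed

lemma thompson_maps_iff:
  "f \<in> thompson_maps \<longleftrightarrow>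
     f \<in> extensional {0..1} \<and> (\<exists>g. homeomorphism {0..1} {0..1} f g) \<and> strict_mono_on {0..1} f \<and>
     (\<exists>B. finite B \<and> B \<subseteq> {0..1} \<and> B \<subseteq> dyadic_rationals \<and> f ` B \<subseteq> dyadic_rationals \<and>
        dyadic_linear_off B f)"
  (is "?L \<longleftrightarrow> ?R")
proof
  assume L: ?L
  then have "finite (breakpoints f)" "breakpoints f \<subseteq> {0..1}"
    "breakpoints f \<subseteq> dyadic_rationals" "f ` breakpoints f \<subseteq> dyadic_rationals"
    "dyadic_linear_off (breakpoints f) f"
    by (auto simp: thompson_maps_def dyadic_linear_off_def) (auto simp: breakpoints_def)
  with L show ?R unfolding thompson_maps_def by blast
next
  assume R: ?R
  then obtain B where B: "finite B" "B \<subseteq> dyadic_rationals" "f ` B \<subseteq> dyadic_rationals"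
    "dyadic_linear_off B f" by blast
  have "breakpoints f \<subseteq> B" by (rule breakpoints_subset[OF B(1,4)])
  moreover have "dyadic_linear_off (breakpoints f) f"
    by (rule dyadic_linear_off_breakpoints[OF B(1,4)])
  ultimately show ?L
    using R B finite_subset[of "breakpoints f" B] unfolding thompson_maps_def dyadic_linear_off_def
    by (simp add: subset_iff image_subset_iff)
qed

lemma thompson_maps_bij:
  assumes "f \<in> thompson_maps"
  shows "f \<in> Bij {0..1}"
proof -
  have "bij_betw f {0..1} {0..1}"
    using assms unfolding thompson_maps_def homeomorphism_def
    by (auto intro: strict_mono_on_imp_inj_on simp: bij_betw_def)
  then show ?thesis using assms by (simp add: Bij_def thompson_maps_def)
qed

lemma thompson_maps_id: "(\<lambda>x\<in>{0..1}. x) \<in> thompson_maps"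
  unfolding thompson_maps_iff
proof (intro conjI)
  show "\<exists>g. homeomorphism {0..1} {0..1} (\<lambda>x\<in>{0..1::real}. x) g"
    by (rule exI[of _ id], rule homeomorphism_cong[of "{0..1}" "{0..1}" id id])
      (auto simp: homeomorphism_ident[unfolded id_def[symmetric]] homeomorphism_def)
  show "strict_mono_on {0..1} (\<lambda>x\<in>{0..1::real}. x)"
    by (simp add: strict_mono_on_def)
  have "dyadic_linear_off {} (\<lambda>x\<in>{0..1}. x)"
    unfolding dyadic_linear_off_def
    by (intro allI impI exI[of _ 0]) auto
  then show "\<exists>B. finite B \<and> B \<subseteq> {0..1} \<and> B \<subseteq> dyadic_rationals \<and>
    (\<lambda>x\<in>{0..1}. x) ` B \<subseteq> dyadic_rationals \<and> dyadic_linear_off B (\<lambda>x\<in>{0..1}. x)"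
    by (intro exI[of _ "{}"]) auto
qed auto

lemma thompson_maps_image_interval:
  assumes f: "f \<in> thompson_maps" and ab: "0 \<le> a" "a < b" "b \<le> 1"
  shows "f ` {a..b} = {f a..f b}" "f ` {a<..<b} = {f a<..<f b}" "0 \<le> f a" "f a < f b" "f b \<le> 1"
proof -
  have mono: "strict_mono_on {0..1} f" and img: "f ` {0..1} = {0..1}"
    using f by (auto simp: thompson_maps_def homeomorphism_def)
  have less: "f x < f y \<longleftrightarrow> x < y" if "x \<in> {0..1}" "y \<in> {0..1}" for x y
    using strict_mono_on_less[OF mono] that by blast
  have le: "f x \<le> f y \<longleftrightarrow> x \<le> y" if "x \<in> {0..1}" "y \<in> {0..1}" for x y
    using less[of y x] that by (meson not_le)
  have in01: "f x \<in> {0..1}" if "x \<in> {0..1}" for x using img that by blast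
  have abI: "a \<in> {0..1}" "b \<in> {0..1}" using ab by auto
  show "0 \<le> f a" "f b \<le> 1" using in01 abI by force+
  show "f a < f b" using less abI ab by blast
  have pre: "\<exists>x\<in>{0..1}. y = f x" if "f a \<le> y" "y \<le> f b" for y
    using img that \<open>0 \<le> f a\<close> \<open>f b \<le> 1\<close> by (metis (no_types) atLeastAtMost_iff imageE order_trans)
  show "f ` {a..b} = {f a..f b}"
  proof
    show "f ` {a..b} \<subseteq> {f a..f b}" using le ab by auto
    show "{f a..f b} \<subseteq> f ` {a..b}"
    proof
      fix y assume y: "y \<in> {f a..f b}"
      then obtain x where x: "x \<in> {0..1}" "y = f x" 
        using pre[of y] by (metis atLeastAtMost_iff)
      then have "x \<in> {a..b}" using y le abI by auto
      then show "y \<in> f ` {a..b}" using x by blast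
    qed
  qed
  show "f ` {a<..<b} = {f a<..<f b}"
  proof
    show "f ` {a<..<b} \<subseteq> {f a<..<f b}" using less ab by auto
    show "{f a<..<f b} \<subseteq> f ` {a<..<b}"
    proof
      fix y assume y: "y \<in> {f a<..<f b}"
      then obtain x where x: "x \<in> {0..1}" "y = f x"
        using pre[of y] by (metis greaterThanLessThan_iff less_imp_le)
      then have "x \<in> {a<..<b}" using y less abI by auto
      then show "y \<in> f ` {a<..<b}" using x by blast
    qed
  qed
qed

lemma thompson_maps_inverse:
  assumes f: "f \<in> thompson_maps"
  shows "(\<lambda>x\<in>{0..1}. inv_into {0..1} f x) \<in> thompson_maps" (is "?h \<in> _")
proof -
  obtain g B where mono: "strict_mono_on {0..1} f" and hom: "homeomorphism {0..1} {0..1} f g"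
    and B: "finite B" "B \<subseteq> {0..1}" "B \<subseteq> dyadic_rationals" "f ` B \<subseteq> dyadic_rationals"
      "dyadic_linear_off B f"
    using f unfolding thompson_maps_iff by blast
  have inj: "inj_on f {0..1}" using mono by (rule strict_mono_on_imp_inj_on)
  have img: "f ` {0..1} = {0..1}" using hom by (simp add: homeomorphism_def)
  have hf: "?h (f x) = x" if "x \<in> {0..1}" for x
    using that inj img by (metis imageI inv_into_f_f restrict_apply')
  have fh: "f (?h y) = y" "?h y \<in> {0..1}" if "y \<in> {0..1}" for y
    using that img by (metis f_inv_into_f restrict_apply') (metis that img inv_into_into restrict_apply')
  have hg: "?h y = g y" if "y \<in> {0..1}" for y
    using fh[OF that] hom hf by (metis homeomorphism_def)
  have homh: "homeomorphism {0..1} {0..1} ?h f"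
    by (rule homeomorphism_cong[OF homeomorphism_sym[THEN iffD1, OF hom]]) (use hg in auto)
  have monoh: "strict_mono_on {0..1} ?h"
  proof (rule strict_mono_onI)
    fix r s :: real assume rs: "r \<in> {0..1}" "s \<in> {0..1}" "r < s"
    show "?h r < ?h s"
      using strict_mono_on_less[OF mono fh(2)[OF rs(1)] fh(2)[OF rs(2)]] rs fh(1) by metis
  qed
  have lin: "dyadic_linear_off (f ` B) ?h"
    unfolding dyadic_linear_off_def
  proof (intro allI impI)
    fix a b :: real
    assume ab: "0 \<le> a \<and> a < b \<and> b \<le> 1 \<and> {a<..<b} \<inter> f ` B = {}"
    then have abI: "a \<in> {0..1}" "b \<in> {0..1}" by auto
    define u v where "u = ?h a" and "v = ?h b"
    have uv: "0 \<le> u" "u < v" "v \<le> 1"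
      using fh(2)[OF abI(1)] fh(2)[OF abI(2)] strict_mono_onD[OF monoh abI] ab
      unfolding u_def v_def by (simp_all del: restrict_apply)
    have fuv: "f u = a" "f v = b" using fh abI by (auto simp: u_def v_def simp del: restrict_apply)
    have "{u<..<v} \<inter> B = {}"
      using thompson_maps_image_interval(2)[OF f uv] ab fuv by blast
    then obtain n c where n: "\<forall>x\<in>{u..v}. f x = 2 powi n * x + c"
      using B(5) uv unfolding dyadic_linear_off_def by blast
    have "\<forall>y\<in>{a..b}. ?h y = 2 powi (- n) * y + (- (2 powi (- n) * c))"
    proof
      fix y assume "y \<in> {a..b}"
      then obtain x where x: "x \<in> {u..v}" "y = f x"
        using thompson_maps_image_interval(1)[OF f uv] fuv by blast
      then have "?h y = x" using hf[of x] uv by (simp del: restrict_apply)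
      moreover have "y = 2 powi n * x + c" using n x by blast
      moreover have "(2::real) powi (- n) * 2 powi n = 1"
        by (simp add: power_int_minus)
      then have "x = 2 powi (- n) * (2 powi n * x + c) + (- (2 powi (- n) * c))"
        by (simp add: distrib_left mult.assoc[symmetric])
      ultimately show "?h y = 2 powi (- n) * y + (- (2 powi (- n) * c))"
        by metis
    qed
    then show "\<exists>(n::int) c. \<forall>x\<in>{a..b}. ?h x = 2 powi n * x + c" by blast
  qed
  have "?h ` f ` B \<subseteq> dyadic_rationals"
    using hf B(2,3) by (auto simp: subset_iff simp del: restrict_apply)
  moreover have "f ` B \<subseteq> {0..1}" using B(2) img by blast
  ultimately show ?thesis
    unfolding thompson_maps_iff using homh monoh lin B(1,4) by blast
qed

lemma dyadic_rationals_add: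
  assumes "x \<in> dyadic_rationals" "y \<in> dyadic_rationals"
  shows "x + y \<in> dyadic_rationals"
proof -
  obtain k m l n where "x = real_of_int k / 2 ^ m" "y = real_of_int l / 2 ^ n"
    using assms by (auto simp: dyadic_rationals_def)
  then have "x + y = real_of_int (k * 2 ^ n + l * 2 ^ m) / 2 ^ (m + n)"
    by (simp add: add_frac_eq power_add)
  then show ?thesis unfolding dyadic_rationals_def by blast
qed

lemma dyadic_rationals_mult:
  assumes "x \<in> dyadic_rationals" "y \<in> dyadic_rationals"
  shows "x * y \<in> dyadic_rationals"
proof -
  obtain k m l n where "x = real_of_int k / 2 ^ m" "y = real_of_int l / 2 ^ n"
    using assms by (auto simp: dyadic_rationals_def)
  then have "x * y = real_of_int (k * l) / 2 ^ (m + n)"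
    by (simp add: power_add)
  then show ?thesis unfolding dyadic_rationals_def by blast
qed

lemma dyadic_rationals_of_int: "real_of_int k \<in> dyadic_rationals"
proof -
  have "real_of_int k = real_of_int k / 2 ^ 0" by simp
  then show ?thesis unfolding dyadic_rationals_def by blast
qed

lemma dyadic_rationals_powi: "2 powi n \<in> dyadic_rationals"
proof (cases "n \<ge> 0")
  case True
  then have "(2::real) powi n = real_of_int (2 ^ nat n)" by (simp add: power_int_def)
  then show ?thesis using dyadic_rationals_of_int by metis
next
  case False
  then have "(2::real) powi n = real_of_int 1 / 2 ^ nat (- n)"
    by (simp add: power_int_def inverse_eq_divide power_divide)
  then show ?thesis unfolding dyadic_rationals_def by blast
qed

lemma dyadic_rationals_diff:
  assumes "x \<in> dyadic_rationals" "y \<in> dyadic_rationals"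
  shows "x - y \<in> dyadic_rationals"
proof -
  have "x - y = x + real_of_int (- 1) * y" by simp
  then show ?thesis
    using assms dyadic_rationals_add dyadic_rationals_mult dyadic_rationals_of_int by metis
qed

lemma thompson_maps_0:
  assumes "f \<in> thompson_maps"
  shows "f 0 = 0"
proof -
  note im = thompson_maps_image_interval[OF assms, of 0 1]
  have "f ` {0..1} = {0..1}"
    using assms by (auto simp: thompson_maps_def homeomorphism_def)
  then have "{f 0..f 1} = {0..1}" using im(1) by simp
  then show ?thesis using im(4) by (simp add: Icc_eq_Icc)
qed

lemma thompson_maps_dyadic:
  assumes f: "f \<in> thompson_maps" and x: "x \<in> {0..1}" "x \<in> dyadic_rationals"
  shows "f x \<in> dyadic_rationals"
proof -
  obtain B where B: "finite B" "B \<subseteq> {0..1}" "B \<subseteq> dyadic_rationals" "f ` B \<subseteq> dyadic_rationals"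
      "dyadic_linear_off B f"
    using f unfolding thompson_maps_iff by blast
  have zero: "0 \<in> dyadic_rationals" using dyadic_rationals_of_int[of 0] by simp
  define S where "S = insert 0 {b \<in> B. b \<le> x}"
  have S: "finite S" "S \<noteq> {}" using B(1) by (auto simp: S_def)
  define a where "a = Max S"
  have "a \<in> S" using Max_in[OF S] by (simp add: a_def)
  then have a: "0 \<le> a" "a \<le> x" "a \<in> dyadic_rationals" "f a \<in> dyadic_rationals"
    using B(2-4) x zero thompson_maps_0[OF f] by (auto simp: S_def)
  show ?thesis
  proof (cases "a = x")
    case True
    then show ?thesis using a by simp
  next
    case False
    have "{a<..<x} \<inter> B = {}"
    proof (rule ccontr)
      assume "\<not> ?thesis"
      then obtain b where b: "a < b" "b < x" "b \<in> B" by auto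
      then have "b \<in> S" by (simp add: S_def)
      then show False using Max_ge[OF S(1), of b] b(1) by (simp add: a_def)
    qed
    then obtain n c where n: "\<forall>y\<in>{a..x}. f y = 2 powi n * y + c"
      using B(5) a False x unfolding dyadic_linear_off_def
      by (metis atLeastAtMost_iff less_eq_real_def)
    have "f x = f a + 2 powi n * (x - a)"
      using n[rule_format, of a] n[rule_format, of x] a(2) by (simp add: algebra_simps)
    then show ?thesis
      using dyadic_rationals_add[OF a(4) dyadic_rationals_mult[OF dyadic_rationals_powi
            dyadic_rationals_diff[OF x(2) a(3)]]] by simp
  qed
qed

lemma thompson_maps_compose:
  assumes f: "f \<in> thompson_maps" and g: "g \<in> thompson_maps"
  shows "compose {0..1} f g \<in> thompson_maps"
proof -
  obtain f' B where mf: "strict_mono_on {0..1} f" and hf: "homeomorphism {0..1} {0..1} f f'"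
    and B: "finite B" "B \<subseteq> {0..1}" "B \<subseteq> dyadic_rationals" "f ` B \<subseteq> dyadic_rationals"
      "dyadic_linear_off B f"
    using f unfolding thompson_maps_iff by blast
  obtain g' C where mg: "strict_mono_on {0..1} g" and hg: "homeomorphism {0..1} {0..1} g g'"
    and C: "finite C" "C \<subseteq> {0..1}" "C \<subseteq> dyadic_rationals" "g ` C \<subseteq> dyadic_rationals"
      "dyadic_linear_off C g"
    using g unfolding thompson_maps_iff by blast
  define h where "h = compose {0..1} f g"
  have h: "h x = f (g x)" if "x \<in> {0..1}" for x using that by (simp add: h_def compose_def)
  have gI: "g x \<in> {0..1}" if "x \<in> {0..1}" for x
    using hg that by (auto simp: homeomorphism_def)
  have homh: "homeomorphism {0..1} {0..1} h (g' \<circ> f')"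
    by (rule homeomorphism_cong[OF homeomorphism_compose[OF hg hf]]) (auto simp: h)
  have monoh: "strict_mono_on {0..1} h"
    using mf mg gI h by (simp add: strict_mono_on_def)
  have bij_g: "{0..1} = g ` {0..1}" using hg by (simp add: homeomorphism_def)
  define gi where "gi = (\<lambda>x\<in>{0..1}. inv_into {0..1} g x)"
  have gi: "gi \<in> thompson_maps" unfolding gi_def by (rule thompson_maps_inverse[OF g])
  have inj: "inj_on g {0..1}" using mg by (rule strict_mono_on_imp_inj_on)
  have ggi: "g (gi y) = y" "gi y \<in> {0..1}" if "y \<in> {0..1}" for y
    using that bij_g f_inv_into_f[of y g "{0..1}"] inv_into_into[of y g "{0..1}"]
    by (auto simp: gi_def)
  have gig: "gi (g x) = x" if "x \<in> {0..1}" for x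
    using that gI[OF that] inj by (simp add: gi_def)
  define E where "E = C \<union> gi ` B"
  have E01: "E \<subseteq> {0..1}" using C(2) B(2) ggi(2) by (auto simp: E_def subset_iff)
  have ED: "E \<subseteq> dyadic_rationals"
    using C(3) B(2,3) thompson_maps_dyadic[OF gi] by (auto simp: E_def subset_iff)
  have hED: "h ` E \<subseteq> dyadic_rationals"
  proof
    fix y assume "y \<in> h ` E"
    then obtain x where x: "x \<in> E" "y = h x" by blast
    then have "x \<in> {0..1}" "x \<in> dyadic_rationals" using E01 ED by blast+
    then show "y \<in> dyadic_rationals"
      using h[of x] gI[of x] thompson_maps_dyadic[OF f] thompson_maps_dyadic[OF g] x(2) by metis
  qed
  have lin: "dyadic_linear_off E h"
    unfolding dyadic_linear_off_def
  proof (intro allI impI)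
    fix a b :: real
    assume ab: "0 \<le> a \<and> a < b \<and> b \<le> 1 \<and> {a<..<b} \<inter> E = {}"
    then have ab': "0 \<le> a" "a < b" "b \<le> 1" by auto
    note im = thompson_maps_image_interval[OF g ab']
    have "{a<..<b} \<inter> C = {}" using ab by (auto simp: E_def)
    then obtain n c where n: "\<forall>x\<in>{a..b}. g x = 2 powi n * x + c"
      using C(5) ab' unfolding dyadic_linear_off_def by blast
    have "{g a<..<g b} \<inter> B = {}"
    proof (rule ccontr)
      assume "\<not> ?thesis"
      then obtain y where y: "y \<in> g ` {a<..<b}" "y \<in> B" using im(2) by blast
      then obtain x where x: "x \<in> {a<..<b}" "y = g x" by blast
      then have "gi y = x" using gig[of x] ab' by auto
      then have "x \<in> E" using y by (auto simp: E_def)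
      then show False using ab x by blast
    qed
    then obtain m d where m: "\<forall>y\<in>{g a..g b}. f y = 2 powi m * y + d"
      using B(5) im(3-5) unfolding dyadic_linear_off_def by blast
    have "\<forall>x\<in>{a..b}. h x = 2 powi (m + n) * x + (2 powi m * c + d)"
    proof
      fix x assume x: "x \<in> {a..b}"
      then have "g x \<in> {g a..g b}" using im(1) by blast
      then have "f (g x) = 2 powi m * (2 powi n * x + c) + d" using m n x by metis
      moreover have "h x = f (g x)" using h x ab' by auto
      ultimately show "h x = 2 powi (m + n) * x + (2 powi m * c + d)"
        by (simp add: power_int_add algebra_simps)
    qed
    then show "\<exists>(n::int) c. \<forall>x\<in>{a..b}. h x = 2 powi n * x + c" by blast
  qed
  have "finite E" using B(1) C(1) by (simp add: E_def)
  moreover have "h \<in> extensional {0..1}" by (simp add: h_def)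
  ultimately have "h \<in> thompson_maps"
    unfolding thompson_maps_iff using homh monoh lin E01 ED hED by blast
  then show ?thesis by (simp add: h_def)
qed

lemma subgroup_thompson_maps: "subgroup thompson_maps (BijGroup {0..1})"
proof (rule group.subgroupI[OF group_BijGroup])
  show "thompson_maps \<subseteq> carrier (BijGroup {0..1})"
    using thompson_maps_bij by (auto simp: BijGroup_def)
  show "thompson_maps \<noteq> {}" using thompson_maps_id by blast
  show "m_inv (BijGroup {0..1}) f \<in> thompson_maps" if "f \<in> thompson_maps" for f
    using thompson_maps_inverse[OF that] thompson_maps_bij[OF that]
    by (simp add: inv_BijGroup del: restrict_apply)
  show "f \<otimes>\<^bsub>BijGroup {0..1}\<^esub> g \<in> thompson_maps"
    if "f \<in> thompson_maps" "g \<in> thompson_maps" for f g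
    using thompson_maps_compose[OF that] thompson_maps_bij that by (simp add: BijGroup_def)
qed

lemma group_thompson_F: "group thompson_F"
  unfolding thompson_F_def
  by (rule subgroup.subgroup_is_group[OF subgroup_thompson_maps group_BijGroup])

end

theory Submission
  imports Defs
begin

text \<open>A piecewise linear homeomorphism \<open>to_unit\<close> from the real line onto \<open>(0,1)\<close>, with dyadic
  breakpoints accumulating only at the ends, turns the maps \<open>x \<mapsto> 2\<^sup>n x\<close> near 0 and
  \<open>x \<mapsto> 1 - 2\<^sup>m (1 - x)\<close> near 1 into integer translations near \<open>-\<infinity>\<close> and \<open>+\<infinity>\<close>. So Thompson's
  group becomes the group of those dyadic piecewise linear homeomorphisms of the line that are
  integer translations near both ends (\<open>unit_conj_thompson_line\<close>, \<open>thompson_maps_unit_conj\<close>). Any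
  dyadic piecewise linear homeomorphism \<open>g\<close> of the line that commutes with \<open>t \<mapsto> t + 1\<close> normalises
  this group, even though \<open>g\<close> may have infinitely many breakpoints (\<open>thompson_line_conj\<close>).

  It remains to find a copy of \<open>\<rat>\<close> among these \<open>g\<close>. For each \<open>n \<ge> 1\<close> there is a dyadic piecewise
  linear homeomorphism \<open>k\<^sub>n\<close> with \<open>k\<^sub>n (t + 1) = k\<^sub>n t + n\<close> (\<open>ex_stretch\<close>). The composite
  \<open>K\<^sub>n = k\<^sub>n \<circ> \<dots> \<circ> k\<^sub>1\<close> then satisfies \<open>K\<^sub>n (t + 1) = K\<^sub>n t + n!\<close>, so that
  \<open>t \<mapsto> K\<^sub>n\<inverse> (K\<^sub>n t + 1)\<close> is an \<open>n!\<close>-th root of the unit translation. These roots are compatible: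
  for a rational \<open>r\<close> the map \<open>t \<mapsto> K\<^sub>n\<inverse> (K\<^sub>n t + r n!)\<close> does not depend on \<open>n\<close> as long as \<open>r n!\<close> is an
  integer (\<open>tower_rat_step\<close>). This defines an action of \<open>\<rat>\<close> on the line in which every \<open>r \<noteq> 0\<close> acts
  without fixed points. Conjugation by it is faithful on Thompson's group: a map commuting with an
  element whose fixed point set is \<open>(-\<infinity>,0]\<close> must fix 0.

  Piecewise linearity is treated through one-sided germs. These compose and invert pointwise, and
  finiteness of the set of breakpoints on a compact interval is recovered by a bisection argument.\<close>


section \<open>Dyadic piecewise linear germs\<close>

lemma powi_minus_cancel [simp]:
  fixes x :: real
  shows "2 powi (- n) * (2 powi n * x) = x" "2 powi n * (2 powi (- n) * x) = x"
  by (simp_all add: power_int_minus)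

lemma dyadic_affine_iff:
  assumes "c \<in> dyadic_rationals"
  shows "2 powi n * x + c \<in> dyadic_rationals \<longleftrightarrow> x \<in> dyadic_rationals"
proof
  assume *: "2 powi n * x + c \<in> dyadic_rationals"
  have "2 powi (- n) * ((2 powi n * x + c) - c) \<in> dyadic_rationals"
    by (intro dyadic_rationals_mult dyadic_rationals_powi dyadic_rationals_diff * assms)
  moreover have "2 powi (- n) * ((2 powi n * x + c) - c) = x"
    by simp
  ultimately show "x \<in> dyadic_rationals" by metis
qed (intro dyadic_rationals_add dyadic_rationals_mult dyadic_rationals_powi assms)

lemma dyadic_rationals_minus_iff: "- x \<in> dyadic_rationals \<longleftrightarrow> x \<in> dyadic_rationals"
  using dyadic_rationals_diff[of 0 x] dyadic_rationals_diff[of 0 "- x"] dyadic_rationals_of_int[of 0]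
  by auto

text \<open>The germ of \<open>f\<close> at \<open>x\<close> along \<open>F\<close>, in practice \<^term>\<open>at_right x\<close> or \<^term>\<open>at_left x\<close>, is affine with
  slope \<open>2\<^sup>n\<close> and continuous at \<open>x\<close>.\<close>

definition affine_germ :: "(real \<Rightarrow> real) \<Rightarrow> int \<Rightarrow> real \<Rightarrow> real filter \<Rightarrow> bool" where
  "affine_germ f n x F \<longleftrightarrow> (\<forall>\<^sub>F y in F. f y = f x + 2 powi n * (y - x))"

text \<open>Dyadic piecewise linearity at a point: both one-sided germs are affine with slope a power of 2,
  the slope changes only at dyadic points, and \<open>x\<close> is dyadic exactly when \<open>f x\<close> is. The equivalence
  makes the property stable under composition and inversion.\<close>

definition pl_at :: "(real \<Rightarrow> real) \<Rightarrow> real \<Rightarrow> bool" where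
  "pl_at f x \<longleftrightarrow> (x \<in> dyadic_rationals \<longleftrightarrow> f x \<in> dyadic_rationals) \<and>
     (\<exists>n m. affine_germ f n x (at_right x) \<and> affine_germ f m x (at_left x) \<and>
        (x \<in> dyadic_rationals \<or> n = m))"

lemma filterlim_scale_at_right:
  fixes c :: real
  assumes "c > 0"
  shows "filterlim (\<lambda>y. b + c * (y - x)) (at_right b) (at_right x)"
proof -
  have "tendsto (\<lambda>y. b + c * (y - x)) (b + c * (x - x)) (at_right x)"
    by (intro tendsto_intros)
  moreover have "\<forall>\<^sub>F y in at_right x. b + c * (y - x) \<in> {b<..}"
    using eventually_at_right_less[of x] by eventually_elim (use assms in simp)
  ultimately show ?thesis by (simp add: filterlim_at eventually_conj_iff) (auto elim: eventually_mono)
qed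

lemma filterlim_scale_at_left:
  fixes c :: real
  assumes "c > 0"
  shows "filterlim (\<lambda>y. b + c * (y - x)) (at_left b) (at_left x)"
proof -
  have "tendsto (\<lambda>y. b + c * (y - x)) (b + c * (x - x)) (at_left x)"
    by (intro tendsto_intros)
  moreover have "\<forall>\<^sub>F y in at_left x. y < x"
    by (simp add: eventually_at_filter)
  then have "\<forall>\<^sub>F y in at_left x. b + c * (y - x) \<in> {..<b}"
    by eventually_elim (use assms in \<open>simp add: mult_pos_neg\<close>)
  ultimately show ?thesis by (simp add: filterlim_at eventually_conj_iff) (auto elim: eventually_mono)
qed

lemma affine_germ_compose:
  assumes f: "affine_germ f n x F" and g: "affine_germ g m (f x) G"
    and lim: "filterlim (\<lambda>y. f x + 2 powi n * (y - x)) G F"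
  shows "affine_germ (g \<circ> f) (m + n) x F"
proof -
  have "\<forall>\<^sub>F y in F. g (f x + 2 powi n * (y - x)) = g (f x) + 2 powi m * (f x + 2 powi n * (y - x) - f x)"
    using lim g unfolding affine_germ_def filterlim_iff by blast
  with f[unfolded affine_germ_def] show ?thesis
    unfolding affine_germ_def
    by eventually_elim (simp add: power_int_add)
qed

lemma affine_germ_inverse:
  assumes f: "affine_germ f n x F" and inv: "\<forall>\<^sub>F y in F. g (f y) = y" "g (f x) = x"
    and lim: "filterlim (\<lambda>z. x + 2 powi (- n) * (z - f x)) F G"
  shows "affine_germ g (- n) (f x) G"
proof -
  have "\<forall>\<^sub>F y in F. g (f x + 2 powi n * (y - x)) = y"
    using f[unfolded affine_germ_def] inv(1) by eventually_elim simp
  then have "\<forall>\<^sub>F z in G. g (f x + 2 powi n * (x + 2 powi (- n) * (z - f x) - x)) = x + 2 powi (- n) * (z - f x)"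
    using lim unfolding filterlim_iff by blast
  then show ?thesis unfolding affine_germ_def
    by eventually_elim (simp add: inv(2))
qed

lemma pl_at_compose:
  assumes f: "pl_at f x" and g: "pl_at g (f x)"
  shows "pl_at (g \<circ> f) x"
proof -
  obtain n m where f': "affine_germ f n x (at_right x)" "affine_germ f m x (at_left x)"
    "x \<in> dyadic_rationals \<or> n = m" and fd: "x \<in> dyadic_rationals \<longleftrightarrow> f x \<in> dyadic_rationals"
    using f unfolding pl_at_def by blast
  obtain n' m' where g': "affine_germ g n' (f x) (at_right (f x))" "affine_germ g m' (f x) (at_left (f x))"
    "f x \<in> dyadic_rationals \<or> n' = m'" and gd: "f x \<in> dyadic_rationals \<longleftrightarrow> g (f x) \<in> dyadic_rationals"
    using g unfolding pl_at_def by blast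
  have "affine_germ (g \<circ> f) (n' + n) x (at_right x)"
    by (rule affine_germ_compose[OF f'(1) g'(1) filterlim_scale_at_right]) simp
  moreover have "affine_germ (g \<circ> f) (m' + m) x (at_left x)"
    by (rule affine_germ_compose[OF f'(2) g'(2) filterlim_scale_at_left]) simp
  moreover have "x \<in> dyadic_rationals \<or> n' + n = m' + m" using f'(3) g'(3) fd by auto
  ultimately show ?thesis using fd gd unfolding pl_at_def comp_def by blast
qed

lemma pl_at_inverse:
  assumes f: "pl_at f x" and inv: "\<forall>\<^sub>F y in nhds x. g (f y) = y"
  shows "pl_at g (f x)"
proof -
  obtain n m where f': "affine_germ f n x (at_right x)" "affine_germ f m x (at_left x)"
    "x \<in> dyadic_rationals \<or> n = m" and fd: "x \<in> dyadic_rationals \<longleftrightarrow> f x \<in> dyadic_rationals"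
    using f unfolding pl_at_def by blast
  have gx: "g (f x) = x" using inv by (rule eventually_nhds_x_imp_x)
  have inv': "\<forall>\<^sub>F y in at x within S. g (f y) = y" for S
    using inv unfolding eventually_at_filter by eventually_elim simp
  have "affine_germ g (- n) (f x) (at_right (f x))"
    by (rule affine_germ_inverse[OF f'(1) inv' gx filterlim_scale_at_right]) simp
  moreover have "affine_germ g (- m) (f x) (at_left (f x))"
    by (rule affine_germ_inverse[OF f'(2) inv' gx filterlim_scale_at_left]) simp
  ultimately show ?thesis using fd f'(3) gx unfolding pl_at_def by (metis)
qed

lemma pl_at_cong:
  assumes f: "pl_at f x" and eq: "\<forall>\<^sub>F y in nhds x. g y = f y"
  shows "pl_at g x"
proof -
  have gx: "g x = f x" using eq by (rule eventually_nhds_x_imp_x)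
  have "affine_germ g n x (at x within S)" if "affine_germ f n x (at x within S)" for n S
  proof -
    have "\<forall>\<^sub>F y in at x within S. g y = f y"
      using eq unfolding eventually_at_filter by eventually_elim simp
    with that[unfolded affine_germ_def] show ?thesis
      unfolding affine_germ_def by eventually_elim (simp add: gx)
  qed
  then show ?thesis using f gx unfolding pl_at_def by metis
qed

lemma pl_atI:
  assumes "a < x" "x < b" "c \<in> dyadic_rationals" "d \<in> dyadic_rationals"
    and "\<And>y. x \<le> y \<Longrightarrow> y < b \<Longrightarrow> f y = 2 powi n * y + c"
    and "\<And>y. a < y \<Longrightarrow> y \<le> x \<Longrightarrow> f y = 2 powi m * y + d"
    and "x \<in> dyadic_rationals \<or> n = m"
  shows "pl_at f x"
proof -
  have "affine_germ f n x (at_right x)"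
    unfolding affine_germ_def eventually_at_right_field
    using assms(2,5) by (intro exI[of _ b]) (auto simp: algebra_simps)
  moreover have "affine_germ f m x (at_left x)"
    unfolding affine_germ_def eventually_at_left_field
    using assms(1,6) by (intro exI[of _ a]) (auto simp: algebra_simps)
  moreover have "x \<in> dyadic_rationals \<longleftrightarrow> f x \<in> dyadic_rationals"
    using assms(5)[of x] assms(2,3) dyadic_affine_iff[of c n x] by simp
  ultimately show ?thesis using assms(7) unfolding pl_at_def by blast
qed

lemma pl_at_affine:
  assumes "c \<in> dyadic_rationals"
  shows "pl_at (\<lambda>x. 2 powi n * x + c) x"
  by (rule pl_atI[of "x - 1" x "x + 1" c c _ n n]) (use assms in auto)

lemma pl_at_translation:
  assumes "c \<in> dyadic_rationals"
  shows "pl_at (\<lambda>x. x + c) x"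
  using pl_at_affine[OF assms, of 0] by simp

lemma pl_at_reflect:
  assumes c: "c \<in> dyadic_rationals" and f: "pl_at f (- x)"
  shows "pl_at (\<lambda>x. c - f (- x)) x"
proof -
  obtain n m where f': "affine_germ f n (- x) (at_right (- x))" "affine_germ f m (- x) (at_left (- x))"
    "- x \<in> dyadic_rationals \<or> n = m" and fd: "- x \<in> dyadic_rationals \<longleftrightarrow> f (- x) \<in> dyadic_rationals"
    using f unfolding pl_at_def by blast
  have "affine_germ (\<lambda>x. c - f (- x)) n x (at_left x)"
    using f'(1) unfolding affine_germ_def at_left_minus[of x] eventually_filtermap
    by eventually_elim (simp add: algebra_simps)
  moreover have "affine_germ (\<lambda>x. c - f (- x)) m x (at_right x)"
    using f'(2) unfolding affine_germ_def at_right_minus[of x] eventually_filtermap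
    by eventually_elim (simp add: algebra_simps)
  moreover have "x \<in> dyadic_rationals \<longleftrightarrow> c - f (- x) \<in> dyadic_rationals"
    using fd dyadic_rationals_minus_iff[of x] dyadic_affine_iff[OF c, of 0 "- f (- x)"]
      dyadic_rationals_minus_iff[of "f (- x)"] by simp
  ultimately show ?thesis using f'(3) dyadic_rationals_minus_iff[of x] unfolding pl_at_def by blast
qed

section \<open>From germs to intervals\<close>

text \<open>The one-sided germs of \<open>f\<close> at the points of \<open>[u,v]\<close>, taken within \<open>[u,v]\<close>, are affine with slopes
  powers of 2. Nothing is said about dyadic points, so the condition also makes sense at the ends,
  where one of the two germs is vacuous.\<close>

definition locally_affine :: "real \<Rightarrow> real \<Rightarrow> (real \<Rightarrow> real) \<Rightarrow> bool" where
  "locally_affine u v f \<longleftrightarrow> (\<forall>x\<in>{u..v}. \<exists>d>0. \<exists>n m :: int. \<forall>y\<in>{u..v}.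
     (x < y \<and> y < x + d \<longrightarrow> f y = f x + 2 powi n * (y - x)) \<and>
     (x - d < y \<and> y < x \<longrightarrow> f y = f x + 2 powi m * (y - x)))"

lemma locally_affineE:
  assumes "locally_affine u v f" "x \<in> {u..v}"
  obtains d and n m :: int where "d > 0"
    "\<forall>y\<in>{u..v}. x < y \<longrightarrow> y < x + d \<longrightarrow> f y = f x + 2 powi n * (y - x)"
    "\<forall>y\<in>{u..v}. x - d < y \<longrightarrow> y < x \<longrightarrow> f y = f x + 2 powi m * (y - x)"
  proof -
  have "\<exists>d>0. \<exists>n m :: int. \<forall>y\<in>{u..v}.
     (x < y \<and> y < x + d \<longrightarrow> f y = f x + 2 powi n * (y - x)) \<and>
     (x - d < y \<and> y < x \<longrightarrow> f y = f x + 2 powi m * (y - x))"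
    using assms unfolding locally_affine_def by blast
  then show ?thesis using that by blast
qed

lemma affine_germ_at_right_iff:
  "affine_germ f n x (at_right x) \<longleftrightarrow> (\<exists>d>0. \<forall>y. x < y \<and> y < x + d \<longrightarrow> f y = f x + 2 powi n * (y - x))"
  (is "_ \<longleftrightarrow> ?R")
proof
  assume "affine_germ f n x (at_right x)"
  then obtain b where "b > x" "\<forall>y>x. y < b \<longrightarrow> f y = f x + 2 powi n * (y - x)"
    unfolding affine_germ_def eventually_at_right_field by blast
  then show ?R by (intro exI[of _ "b - x"]) auto
next
  assume ?R
  then obtain d where "d > 0" "\<forall>y. x < y \<and> y < x + d \<longrightarrow> f y = f x + 2 powi n * (y - x)" by blast
  then show "affine_germ f n x (at_right x)"
    unfolding affine_germ_def eventually_at_right_field by (intro exI[of _ "x + d"]) auto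
qed

lemma affine_germ_at_left_iff:
  "affine_germ f n x (at_left x) \<longleftrightarrow> (\<exists>d>0. \<forall>y. x - d < y \<and> y < x \<longrightarrow> f y = f x + 2 powi n * (y - x))"
  (is "_ \<longleftrightarrow> ?R")
proof
  assume "affine_germ f n x (at_left x)"
  then obtain b where "b < x" "\<forall>y>b. y < x \<longrightarrow> f y = f x + 2 powi n * (y - x)"
    unfolding affine_germ_def eventually_at_left_field by blast
  then show ?R by (intro exI[of _ "x - b"]) auto
next
  assume ?R
  then obtain d where "d > 0" "\<forall>y. x - d < y \<and> y < x \<longrightarrow> f y = f x + 2 powi n * (y - x)" by blast
  then show "affine_germ f n x (at_left x)"
    unfolding affine_germ_def eventually_at_left_field by (intro exI[of _ "x - d"]) auto
qed

lemma locally_affineI: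
  assumes R: "\<And>x. u \<le> x \<Longrightarrow> x < v \<Longrightarrow> \<exists>n. affine_germ f n x (at_right x)"
    and L: "\<And>x. u < x \<Longrightarrow> x \<le> v \<Longrightarrow> \<exists>n. affine_germ f n x (at_left x)"
  shows "locally_affine u v f"
  unfolding locally_affine_def
proof
  fix x assume x: "x \<in> {u..v}"
  have "\<exists>d>0. \<exists>n::int. \<forall>y\<in>{u..v}. x < y \<and> y < x + d \<longrightarrow> f y = f x + 2 powi n * (y - x)"
  proof (cases "x = v")
    case True
    then show ?thesis by (intro exI[of _ 1]) auto
  next
    case False
    then obtain n where "affine_germ f n x (at_right x)" using R[of x] x by auto
    then show ?thesis unfolding affine_germ_at_right_iff by blast
  qed
  then obtain d and n :: int where d: "d > 0"
    "\<forall>y\<in>{u..v}. x < y \<and> y < x + d \<longrightarrow> f y = f x + 2 powi n * (y - x)" by blast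
  have "\<exists>d>0. \<exists>n::int. \<forall>y\<in>{u..v}. x - d < y \<and> y < x \<longrightarrow> f y = f x + 2 powi n * (y - x)"
  proof (cases "x = u")
    case True
    then show ?thesis by (intro exI[of _ 1]) auto
  next
    case False
    then obtain n where "affine_germ f n x (at_left x)" using L[of x] x by auto
    then show ?thesis unfolding affine_germ_at_left_iff by blast
  qed
  then obtain e and m :: int where e: "e > 0"
    "\<forall>y\<in>{u..v}. x - e < y \<and> y < x \<longrightarrow> f y = f x + 2 powi m * (y - x)" by blast
  show "\<exists>d>0. \<exists>n m :: int. \<forall>y\<in>{u..v}.
     (x < y \<and> y < x + d \<longrightarrow> f y = f x + 2 powi n * (y - x)) \<and>
     (x - d < y \<and> y < x \<longrightarrow> f y = f x + 2 powi m * (y - x))"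
    using d e by (intro exI[of _ "min d e"] conjI exI[of _ n] exI[of _ m]) auto
qed

lemma pl_at_locally_affine:
  assumes "\<And>x. x \<in> {u..v} \<Longrightarrow> pl_at f x"
  shows "locally_affine u v f"
proof (rule locally_affineI)
  show "\<exists>n. affine_germ f n x (at_right x)" if "u \<le> x" "x < v" for x
    using assms[of x] that unfolding pl_at_def by auto
  show "\<exists>n. affine_germ f n x (at_left x)" if "u < x" "x \<le> v" for x
    using assms[of x] that unfolding pl_at_def by auto
qed

lemma locally_affine_less:
  assumes f: "locally_affine u v f" and ab: "u \<le> a" "a < b" "b \<le> v"
  shows "f a < f b"
proof -
  define P where "P p q \<longleftrightarrow> u \<le> p \<and> p < q \<and> q \<le> v \<longrightarrow> f p < f q" for p q
  have "u \<le> v" using ab by simp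
  have "P a b"
    using less_imp_le[OF ab(2)]
  proof (induction rule: Bolzano)
    case (trans p q r)
    show ?case unfolding P_def
    proof
      assume *: "u \<le> p \<and> p < r \<and> r \<le> v"
      then have "p < q \<longrightarrow> f p < f q" "q < r \<longrightarrow> f q < f r"
        using trans unfolding P_def by auto
      then show "f p < f r" using trans(3,4) * by (cases "p = q"; cases "q = r") auto
    qed
  next
    case (local x)
    then have "x \<in> {u..v}" using ab by simp
    then obtain d and n m :: int where d: "d > 0"
    "\<forall>y\<in>{u..v}. x < y \<longrightarrow> y < x + d \<longrightarrow> f y = f x + 2 powi n * (y - x)"
    "\<forall>y\<in>{u..v}. x - d < y \<longrightarrow> y < x \<longrightarrow> f y = f x + 2 powi m * (y - x)"
      by (rule locally_affineE[OF f])
    have "P p q" if pq: "p \<le> x" "x \<le> q" "q - p < d" for p q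
      unfolding P_def
    proof
      assume *: "u \<le> p \<and> p < q \<and> q \<le> v"
      have "f p = f x + 2 powi m * (p - x)" "f q = f x + 2 powi n * (q - x)"
        using d(2)[rule_format, of q] d(3)[rule_format, of p] * pq by (cases "p = x"; force)+
      moreover have "2 powi m * (p - x) \<le> 0" "2 powi n * (q - x) \<ge> 0"
        using pq by (auto simp: mult_le_0_iff)
      moreover have "2 powi m * (p - x) < 0 \<or> 2 powi n * (q - x) > 0"
        using pq * by (cases "p = x") (auto simp: mult_less_0_iff)
      ultimately show "f p < f q" by linarith
    qed
    then show ?case using d(1) by blast
  qed
  then show ?thesis using ab by (simp add: P_def)
qed

text \<open>By bisection: the property passes from two adjacent intervals to their union (the common end
  point is added to the exceptional set), and near \<open>x\<close> the set \<open>{x}\<close> suffices.\<close>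

lemma locally_affine_finite_breaks:
  assumes f: "locally_affine u v f" and uv: "u \<le> v"
  shows "\<exists>B. finite B \<and> (\<forall>a b. u \<le> a \<and> a < b \<and> b \<le> v \<and> {a<..<b} \<inter> B = {} \<longrightarrow>
        (\<exists>(n::int) c. \<forall>x\<in>{a..b}. f x = 2 powi n * x + c))"
proof -
  define P where "P p q \<longleftrightarrow> (\<exists>B. finite B \<and> (\<forall>a b. u \<le> a \<and> p \<le> a \<and> a < b \<and> b \<le> q \<and> b \<le> v \<and> {a<..<b} \<inter> B = {} \<longrightarrow>
        (\<exists>(n::int) c. \<forall>x\<in>{a..b}. f x = 2 powi n * x + c)))" for p q
  have "P u v"
    using uv
  proof (induction rule: Bolzano)
    case (trans p q r)
    obtain B where B: "finite B" "\<And>a b. u \<le> a \<Longrightarrow> p \<le> a \<Longrightarrow> a < b \<Longrightarrow> b \<le> q \<Longrightarrow> b \<le> v \<Longrightarrow> {a<..<b} \<inter> B = {} \<Longrightarrow>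
        (\<exists>(n::int) c. \<forall>x\<in>{a..b}. f x = 2 powi n * x + c)"
      using trans(1) unfolding P_def by blast
    obtain C where C: "finite C" "\<And>a b. u \<le> a \<Longrightarrow> q \<le> a \<Longrightarrow> a < b \<Longrightarrow> b \<le> r \<Longrightarrow> b \<le> v \<Longrightarrow> {a<..<b} \<inter> C = {} \<Longrightarrow>
        (\<exists>(n::int) c. \<forall>x\<in>{a..b}. f x = 2 powi n * x + c)"
      using trans(2) unfolding P_def by blast
    show ?case unfolding P_def
    proof (intro exI[of _ "insert q (B \<union> C)"] conjI allI impI)
      fix a b assume ab: "u \<le> a \<and> p \<le> a \<and> a < b \<and> b \<le> r \<and> b \<le> v \<and> {a<..<b} \<inter> insert q (B \<union> C) = {}"
      then have e: "{a<..<b} \<inter> B = {}" "{a<..<b} \<inter> C = {}" "b \<le> q \<or> q \<le> a" by auto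
      from e(3) show "\<exists>(n::int) c. \<forall>x\<in>{a..b}. f x = 2 powi n * x + c"
        using B(2)[of a b] C(2)[of a b] e(1,2) ab by blast
    qed (use B C in auto)
  next
    case (local x)
    then have "x \<in> {u..v}" by simp
    then obtain d and n m :: int where d: "d > 0"
    "\<forall>y\<in>{u..v}. x < y \<longrightarrow> y < x + d \<longrightarrow> f y = f x + 2 powi n * (y - x)"
    "\<forall>y\<in>{u..v}. x - d < y \<longrightarrow> y < x \<longrightarrow> f y = f x + 2 powi m * (y - x)"
      by (rule locally_affineE[OF f])
    have "P p q" if pq: "p \<le> x" "x \<le> q" "q - p < d" for p q
      unfolding P_def
    proof (intro exI[of _ "{x}"] conjI allI impI)
      fix a b assume ab: "u \<le> a \<and> p \<le> a \<and> a < b \<and> b \<le> q \<and> b \<le> v \<and> {a<..<b} \<inter> {x} = {}"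
      then consider "b \<le> x" | "x \<le> a" by force
      then show "\<exists>(n::int) c. \<forall>x\<in>{a..b}. f x = 2 powi n * x + c"
      proof cases
        case 1
        then show ?thesis using d(3) ab pq
          by (intro exI[of _ m] exI[of _ "f x - 2 powi m * x"] ballI, rename_tac y, case_tac "y = x")
            (auto simp: algebra_simps)
      next
        case 2
        then show ?thesis using d(2) ab pq
          by (intro exI[of _ n] exI[of _ "f x - 2 powi n * x"] ballI, rename_tac y, case_tac "y = x")
            (auto simp: algebra_simps)
      qed
    qed auto
    then show ?case using d(1) by blast
  qed
  then obtain B where B: "finite B" "\<And>a b. u \<le> a \<and> u \<le> a \<and> a < b \<and> b \<le> v \<and> b \<le> v \<and> {a<..<b} \<inter> B = {} \<Longrightarrow>
        (\<exists>(n::int) c. \<forall>x\<in>{a..b}. f x = 2 powi n * x + c)"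
    unfolding P_def by (elim exE conjE) (rule that, assumption, elim allE impE)
  show ?thesis
    by (intro exI[of _ B] conjI allI impI B) auto
qed

lemma locally_affine_continuous_on:
  assumes f: "locally_affine u v f"
  shows "continuous_on {u..v} f"
  unfolding continuous_on_def
proof
  fix x assume "x \<in> {u..v}"
  then obtain d and n m :: int where d: "d > 0"
    "\<forall>y\<in>{u..v}. x < y \<longrightarrow> y < x + d \<longrightarrow> f y = f x + 2 powi n * (y - x)"
    "\<forall>y\<in>{u..v}. x - d < y \<longrightarrow> y < x \<longrightarrow> f y = f x + 2 powi m * (y - x)"
      by (rule locally_affineE[OF f])
  define K :: real where "K = 2 powi n + 2 powi m"
  have K: "2 powi n \<le> K" "2 powi m \<le> K" by (auto simp: K_def)
  have "\<forall>\<^sub>F y in at x within {u..v}. \<bar>f y - f x\<bar> \<le> \<bar>y - x\<bar> * K"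
    unfolding eventually_at
  proof (intro exI[of _ d] conjI ballI impI)
    fix y assume y: "y \<in> {u..v}" "y \<noteq> x \<and> dist y x < d"
    then have *: "\<bar>y - x\<bar> < d" by (simp add: dist_real_def)
    show "\<bar>f y - f x\<bar> \<le> \<bar>y - x\<bar> * K"
    proof (cases "x < y")
      case True
      then have "f y - f x = 2 powi n * (y - x)" using d(2)[rule_format, of y] y(1) * by simp
      then have "\<bar>f y - f x\<bar> = \<bar>y - x\<bar> * 2 powi n" by (simp add: abs_mult)
      then show ?thesis using mult_left_mono[OF K(1) abs_ge_zero[of "y - x"]] by simp
    next
      case False
      then have "f y - f x = 2 powi m * (y - x)" using d(3)[rule_format, of y] y * by simp
      then have "\<bar>f y - f x\<bar> = \<bar>y - x\<bar> * 2 powi m" by (simp add: abs_mult)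
      then show ?thesis using mult_left_mono[OF K(2) abs_ge_zero[of "y - x"]] by simp
    qed
  qed (use d in auto)
  then have *: "\<forall>\<^sub>F y in at x within {u..v}. norm (f y - f x) \<le> norm (y - x) * K"
    by simp
  have "tendsto (\<lambda>y. y - x) 0 (at x within {u..v})"
    by (rule LIM_zero) (rule tendsto_ident_at)
  then have "tendsto (\<lambda>y. f y - f x) 0 (at x within {u..v})"
    using * by (rule tendsto_0_le)
  then show "tendsto f (f x) (at x within {u..v})" by (rule LIM_zero_cancel)
qed

lemma pl_strict_mono:
  assumes "\<And>x. pl_at f x"
  shows "strict_mono f"
proof (rule strict_monoI)
  fix x y :: real assume "x < y"
  then show "f x < f y"
    using locally_affine_less[OF pl_at_locally_affine[OF assms], of x x y y] by simp
qed

lemma pl_surj: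
  assumes f: "\<And>x. pl_at f x" and unb: "\<And>M. \<exists>x. f x \<le> M" "\<And>M. \<exists>x. M \<le> f x"
  shows "surj f"
proof -
  have "y \<in> range f" for y
  proof -
    obtain a b where ab: "f a \<le> y" "y \<le> f b" using unb by meson
    have "a \<le> b"
      using ab pl_strict_mono[OF f] by (meson order_trans strict_mono_less_eq)
    then show ?thesis
      using IVT'[of f a y b] ab locally_affine_continuous_on[OF pl_at_locally_affine[OF f]] by blast
  qed
  then show ?thesis by blast
qed


section \<open>Dyadic piecewise linear homeomorphisms of the real line\<close>

text \<open>Monotonicity and continuity need not be required, since they follow from the germs being affine
  with positive slopes.\<close>

definition pl_homeo :: "(real \<Rightarrow> real) \<Rightarrow> bool" where
  "pl_homeo u \<longleftrightarrow> surj u \<and> (\<forall>x. pl_at u x)"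

lemma pl_homeo_strict_mono: "pl_homeo u \<Longrightarrow> strict_mono u"
  by (simp add: pl_homeo_def pl_strict_mono)

lemma pl_homeo_le_iff: "pl_homeo u \<Longrightarrow> u x \<le> u y \<longleftrightarrow> x \<le> y"
  by (simp add: pl_homeo_strict_mono strict_mono_less_eq)

lemma pl_homeo_bij: "pl_homeo u \<Longrightarrow> bij u"
  by (simp add: bij_def pl_homeo_strict_mono strict_mono_imp_inj_on pl_homeo_def)

lemma pl_homeo_inv_simps [simp]:
  assumes "pl_homeo u"
  shows "u (inv_into UNIV u x) = x" "inv_into UNIV u (u x) = x"
  using pl_homeo_bij[OF assms] by (simp_all add: bij_def surj_f_inv_f)

lemma pl_homeo_compose: "pl_homeo u \<Longrightarrow> pl_homeo v \<Longrightarrow> pl_homeo (u \<circ> v)"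
  unfolding pl_homeo_def by (metis comp_surj pl_at_compose)

lemma pl_homeo_inv:
  assumes u: "pl_homeo u"
  shows "pl_homeo (inv_into UNIV u)"
  unfolding pl_homeo_def
proof
  show "surj (inv_into UNIV u)" using pl_homeo_bij[OF u] by (simp add: bij_def inj_imp_surj_inv)
  show "\<forall>x. pl_at (inv_into UNIV u) x"
  proof
    fix x
    have "pl_at u (inv_into UNIV u x)" using u by (simp add: pl_homeo_def)
    then have "pl_at (inv_into UNIV u) (u (inv_into UNIV u x))" by (rule pl_at_inverse) (simp add: u)
    then show "pl_at (inv_into UNIV u) x" by (simp add: u)
  qed
qed

lemma pl_homeo_id: "pl_homeo (\<lambda>x. x)"
  using pl_at_translation[of 0] dyadic_rationals_of_int[of 0] by (simp add: pl_homeo_def)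

lemma pl_homeo_translation: "pl_homeo (\<lambda>x. x + real_of_int k)"
proof -
  have "y \<in> range (\<lambda>x. x + real_of_int k)" for y
    by (rule range_eqI[of _ _ "y - real_of_int k"]) simp
  then show ?thesis
    using pl_at_translation[OF dyadic_rationals_of_int] by (auto simp: pl_homeo_def)
qed

section \<open>A rational flow commuting with the unit translation\<close>

text \<open>On \<open>[0,1]\<close> the map has slopes \<open>2b\<close> and \<open>b\<close>, where \<open>b\<close> is the power of 2 with \<open>b \<le> n < 2b\<close>; the slope
  changes at \<open>s = (n - b) / b\<close>, so that the total increase is \<open>2bs + b(1 - s) = n\<close>.\<close>

lemma ex_stretch:
  assumes n: "n \<ge> 1"
  shows "\<exists>k. pl_homeo k \<and> (\<forall>t. k (t + 1) = k t + real n)"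
proof -
  obtain a where a: "2 ^ a \<le> n" "n < 2 ^ (a + 1)"
    using ex_power_ivl1[of 2 n] n by auto
  define b :: real where "b = 2 powi int a"
  have b': "2 ^ a = b" by (simp add: b_def)
  have b: "b > 0" "b \<le> real n" "real n < 2 * b" "2 powi (int a + 1) = 2 * b"
    using a of_nat_le_iff[of "2 ^ a" n, where ?'a = real]
      of_nat_less_iff[of n "2 ^ (a + 1)", where ?'a = real]
    by (simp_all add: b_def power_int_add)
  define s where "s = (real n - b) / b"
  have s: "0 \<le> s" "s < 1" "b * s = real n - b" using b by (simp_all add: s_def field_simps)
  have bD: "b \<in> dyadic_rationals" unfolding b_def by (rule dyadic_rationals_powi)
  have nD: "real n \<in> dyadic_rationals" using dyadic_rationals_of_int[of "int n"] by simp
  have "s = 2 powi (- int a) * (real n - b)"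
    by (simp add: s_def b_def power_int_minus divide_inverse)
  then have sD: "s \<in> dyadic_rationals"
    using dyadic_rationals_mult[OF dyadic_rationals_powi dyadic_rationals_diff[OF nD bD]] by simp
  define k where "k t = real n * of_int \<lfloor>t\<rfloor> + min (2 * b * frac t) (b * frac t + (real n - b))" for t
  have period: "k (t + 1) = k t + real n" for t
    by (simp add: k_def frac_def algebra_simps)
  \<comment> \<open>the two affine pieces over \<open>[j, j + 1]\<close>\<close>
  have k1: "k y = 2 powi (int a + 1) * y + (real n - 2 * b) * of_int j"
    if "of_int j \<le> y" "y \<le> of_int j + s" for y j
  proof -
    have "\<lfloor>y\<rfloor> = j" using that s by linarith
    moreover have "b * (y - of_int j) \<le> b * s" using that b by simp
    ultimately show ?thesis using s b by (simp add: k_def frac_def min_def algebra_simps)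
  qed
  have k2: "k y = 2 powi (int a) * y + (real n - b) * (of_int j + 1)"
    if "of_int j + s \<le> y" "y \<le> of_int j + 1" for y j
  proof (cases "y = of_int j + 1")
    case True
    then have "y = of_int (j + 1)" by simp
    then show ?thesis using b by (simp add: k_def b' algebra_simps)
  next
    case False
    then have "\<lfloor>y\<rfloor> = j" using that s by linarith
    moreover have "b * s \<le> b * (y - of_int j)" using that b by simp
    ultimately show ?thesis
      using s b by (simp add: k_def frac_def min_def b' algebra_simps)
  qed
  have D1: "(real n - 2 * b) * of_int j \<in> dyadic_rationals" for j
    using dyadic_rationals_mult[OF dyadic_rationals_diff[OF nD dyadic_rationals_mult[OF
      dyadic_rationals_of_int[of 2] bD]] dyadic_rationals_of_int] by simp
  have D2: "(real n - b) * (of_int j + 1) \<in> dyadic_rationals" for j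
    using dyadic_rationals_mult[OF dyadic_rationals_diff[OF nD bD] dyadic_rationals_of_int[of "j + 1"]]
    by simp
  have pl: "pl_at k x" for x
  proof -
    define j where "j = \<lfloor>x\<rfloor>"
    have j: "of_int j \<le> x" "x < of_int j + 1" by (simp_all add: j_def)
    have jD: "real_of_int j \<in> dyadic_rationals" by (rule dyadic_rationals_of_int)
    \<comment> \<open>if \<open>s = 0\<close>, that is \<open>n = b\<close>, the first piece is degenerate and the map is linear\<close>
    consider "s = 0" "x = of_int j" | "s > 0" "x = of_int j" | "of_int j < x" "x < of_int j + s"
      | "s > 0" "x = of_int j + s" | "of_int j + s < x" using j s by linarith
    then show ?thesis
    proof cases
      case 1
      then show ?thesis
        by (intro pl_atI[of "of_int j - 1" x "of_int j + 1", OF _ _ D2[of j] D2[of "j - 1"] k2 k2])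
          (use jD in auto)
    next
      case 2
      then show ?thesis using s
        by (intro pl_atI[of "of_int j - 1 + s" x "of_int j + s", OF _ _ D1[of j] D2[of "j - 1"] k1 k2])
          (use jD in auto)
    next
      case 3
      then show ?thesis
        by (intro pl_atI[of "of_int j" x "of_int j + s", OF _ _ D1[of j] D1[of j] k1 k1]) auto
    next
      case 4
      then show ?thesis using s
        by (intro pl_atI[of "of_int j" x "of_int j + 1", OF _ _ D2[of j] D1[of j] k2 k1])
          (use dyadic_rationals_add[OF jD sD] in auto)
    next
      case 5
      then show ?thesis using j
        by (intro pl_atI[of "of_int j + s" x "of_int j + 1", OF _ _ D2[of j] D2[of j] k2 k2]) auto
    qed
  qed
  have kj: "k (of_int j) = real n * of_int j" for j
    using b by (simp add: k_def)
  have "\<exists>x. k x \<le> M" "\<exists>x. M \<le> k x" for M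
  proof -
    define j where "j = \<lceil>\<bar>M\<bar>\<rceil>"
    have "\<bar>M\<bar> \<le> of_int j" by (simp add: j_def)
    also have "\<dots> \<le> real n * of_int j"
      using n calculation mult_right_mono[of 1 "real n" "of_int j"] by simp
    finally have "M \<le> k (of_int j)" "k (of_int (- j)) \<le> M" unfolding kj by auto
    then show "\<exists>x. k x \<le> M" "\<exists>x. M \<le> k x" by blast+
  qed
  then have "surj k" by (intro pl_surj pl)
  with pl period show ?thesis unfolding pl_homeo_def by blast
qed

text \<open>A chosen dyadic piecewise linear conjugator from the translation by 1 to the translation by \<open>n\<close>;
  meaningful for \<open>n \<ge> 1\<close> only.\<close>

definition stretch :: "nat \<Rightarrow> real \<Rightarrow> real" where
  "stretch n = (SOME k. pl_homeo k \<and> (\<forall>t. k (t + 1) = k t + real n))"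

lemma stretch:
  assumes "n \<ge> 1"
  shows "pl_homeo (stretch n)" "stretch n (t + 1) = stretch n t + real n"
  using someI_ex[OF ex_stretch[OF assms]] by (simp_all add: stretch_def)

lemma shift_int:
  fixes k :: "real \<Rightarrow> real"
  assumes "\<And>t. k (t + 1) = k t + c"
  shows "k (t + of_int j) = k t + c * of_int j"
proof (induction j rule: int_induct[of _ 0])
  case (step1 i)
  then show ?case using assms[of "t + of_int i"] by (simp add: algebra_simps)
next
  case (step2 i)
  then show ?case using assms[of "t + of_int (i - 1)"] by (simp add: algebra_simps)
qed simp

text \<open>The composite of the first \<open>n\<close> stretches, which conjugates the translation by 1 to that by \<open>n!\<close>.\<close>

fun tower :: "nat \<Rightarrow> real \<Rightarrow> real" where
  "tower 0 = (\<lambda>t. t)"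
| "tower (Suc n) = stretch (Suc n) \<circ> tower n"

lemma stretch_shift_int:
  assumes "n \<ge> 1"
  shows "stretch n (t + of_int j) = stretch n t + real n * of_int j"
  using stretch(2)[OF assms] by (rule shift_int)

lemma tower_pl_homeo: "pl_homeo (tower n)"
proof (induction n)
  case 0
  then show ?case by (simp add: pl_homeo_id)
next
  case (Suc n)
  then show ?case unfolding tower.simps by (intro pl_homeo_compose stretch(1)) simp
qed

lemma tower_shift: "tower n (t + 1) = tower n t + fact n"
proof (induction n)
  case (Suc n)
  have "tower (Suc n) (t + 1) = stretch (Suc n) (tower n t + of_int (fact n))"
    using Suc by simp
  also have "\<dots> = tower (Suc n) t + fact (Suc n)"
    using stretch_shift_int[of "Suc n" "tower n t" "fact n"] by simp
  finally show ?case .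
qed simp

text \<open>The action of \<open>r\<close> on the line, an analogue of the translation by \<open>r\<close> in the coordinate \<open>tower n\<close>
  scaled by \<open>n!\<close>. Taking \<open>n\<close> to be the denominator of \<open>r\<close> ensures that \<open>r n!\<close> is an integer, as is
  needed for the translation by it to be dyadic and for the later stretches to carry it to a
  translation; by \<open>rat_flow_eq\<close> any larger \<open>n\<close> gives the same map.\<close>

definition rat_flow :: "rat \<Rightarrow> real \<Rightarrow> real" where
  "rat_flow r t = (let n = nat (snd (quotient_of r)) in inv_into UNIV (tower n) (tower n t + of_rat r * fact n))"

text \<open>If \<open>q = r m!\<close> is an integer, the next stretch carries the translation by \<open>q\<close> to that by
  \<open>(m + 1) q = r (m + 1)!\<close>, so passing from \<open>m\<close> to \<open>m + 1\<close> does not change the conjugate.\<close>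

lemma tower_rat_step:
  assumes "of_rat r * fact n = real_of_int p" "n \<le> m"
  shows "inv_into UNIV (tower m) (tower m t + of_rat r * fact m) = inv_into UNIV (tower n) (tower n t + of_rat r * fact n)"
  using assms(2)
proof (induction m rule: dec_induct)
  case (step m)
  obtain q where q: "of_rat r * fact m = real_of_int q"
  proof -
    obtain d where "fact m = fact n * (d :: nat)" using fact_dvd[OF step(1)] by (metis dvd_def)
    then have "fact m = fact n * real d" by (metis of_nat_fact of_nat_mult)
    then have "of_rat r * fact m = real_of_int (p * int d)"
      using assms(1) by (simp add: mult.assoc[symmetric])
    then show ?thesis by (rule that)
  qed
  define s where "s = inv_into UNIV (tower m) (tower m t + of_rat r * fact m)"
  have "tower m s = tower m t + of_int q"
    unfolding s_def q by (simp add: tower_pl_homeo)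
  then have "tower (Suc m) s = tower (Suc m) t + real (Suc m) * of_int q"
    using stretch_shift_int[of "Suc m" "tower m t" q] by simp
  also have "\<dots> = tower (Suc m) t + of_rat r * fact (Suc m)"
    by (simp flip: q)
  finally have "inv_into UNIV (tower (Suc m)) (tower (Suc m) t + of_rat r * fact (Suc m)) = s"
    using pl_homeo_inv_simps(2)[OF tower_pl_homeo] by metis
  then show ?case using step.IH unfolding s_def by (rule trans)
qed simp

lemma of_rat_mult_fact_denominator:
  "\<exists>p. of_rat r * fact (nat (snd (quotient_of r))) = real_of_int p"
proof -
  obtain a b where ab: "quotient_of r = (a, b)" by fastforce
  then have b: "b > 0" "r = of_int a / of_int b"
    by (simp_all add: quotient_of_denom_pos quotient_of_div)
  then have "nat b dvd fact (nat b)" by (intro dvd_fact) auto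
  then obtain d where "fact (nat b) = nat b * d" by (metis dvd_def)
  then have "fact (nat b) = real (nat b) * real d" by (metis of_nat_fact of_nat_mult)
  then have "fact (nat b) = of_int b * real d" using b by simp
  then have "of_rat r * fact (nat b) = real_of_int (a * int d)"
    using b by (simp add: of_rat_divide)
  then show ?thesis using ab by (metis snd_conv)
qed

lemma rat_flow_eq:
  assumes "nat (snd (quotient_of r)) \<le> n"
  shows "rat_flow r t = inv_into UNIV (tower n) (tower n t + of_rat r * fact n)"
    and "\<exists>p. of_rat r * fact n = real_of_int p"
proof -
  define d where "d = nat (snd (quotient_of r))"
  obtain p where p: "of_rat r * fact d = real_of_int p"
    unfolding d_def using of_rat_mult_fact_denominator by blast
  show "rat_flow r t = inv_into UNIV (tower n) (tower n t + of_rat r * fact n)"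
    using tower_rat_step[OF p, of n t] assms by (simp add: rat_flow_def d_def Let_def)
  obtain e where "fact n = fact d * (e :: nat)" using fact_dvd[OF assms] unfolding d_def by (metis dvd_def)
  then have "fact n = fact d * real e" by (metis of_nat_fact of_nat_mult)
  then have "of_rat r * fact n = real_of_int (p * int e)"
    using p by (simp add: mult.assoc[symmetric])
  then show "\<exists>p. of_rat r * fact n = real_of_int p" by blast
qed

lemma rat_flow_pl_homeo: "pl_homeo (rat_flow r)"
proof -
  define n where "n = nat (snd (quotient_of r))"
  obtain p where p: "of_rat r * fact n = real_of_int p"
    unfolding n_def using of_rat_mult_fact_denominator by blast
  have "rat_flow r = inv_into UNIV (tower n) \<circ> ((\<lambda>x. x + real_of_int p) \<circ> tower n)"
    using p by (auto simp: rat_flow_def n_def Let_def)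
  then show ?thesis
    using pl_homeo_compose[OF pl_homeo_inv[OF tower_pl_homeo]
      pl_homeo_compose[OF pl_homeo_translation tower_pl_homeo]] by simp
qed

lemma rat_flow_add: "rat_flow (r + s) t = rat_flow r (rat_flow s t)"
proof -
  define n where "n = Max {nat (snd (quotient_of r)), nat (snd (quotient_of s)), nat (snd (quotient_of (r + s)))}"
  have "nat (snd (quotient_of r)) \<le> n" "nat (snd (quotient_of s)) \<le> n"
    "nat (snd (quotient_of (r + s))) \<le> n" by (simp_all add: n_def)
  note eq = this[THEN rat_flow_eq(1)]
  show ?thesis unfolding eq by (simp add: tower_pl_homeo of_rat_add algebra_simps)
qed

lemma rat_flow_shift: "rat_flow r (t + 1) = rat_flow r t + 1"
proof -
  define n where "n = nat (snd (quotient_of r))"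
  have eq: "rat_flow r t = inv_into UNIV (tower n) (tower n t + of_rat r * fact n)" for t
    by (simp add: rat_flow_def n_def Let_def)
  have "tower n (rat_flow r t + 1) = tower n (t + 1) + of_rat r * fact n"
    by (simp add: tower_shift eq tower_pl_homeo)
  then have "rat_flow r t + 1 = inv_into UNIV (tower n) (tower n (t + 1) + of_rat r * fact n)"
    using pl_homeo_inv_simps(2)[OF tower_pl_homeo] by metis
  then show ?thesis by (simp add: eq)
qed

lemma rat_flow_fixpoint:
  assumes "rat_flow r t = t"
  shows "r = 0"
proof -
  define n where "n = nat (snd (quotient_of r))"
  have "inv_into UNIV (tower n) (tower n t + of_rat r * fact n) = t"
    using assms by (simp add: rat_flow_def n_def Let_def)
  then have "tower n t + of_rat r * fact n = tower n t"
    using pl_homeo_inv_simps(1)[OF tower_pl_homeo] by metis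
  then show ?thesis by simp
qed

section \<open>A piecewise linear coordinate on the open unit interval\<close>

text \<open>The piecewise linear interpolation of \<open>2\<^sup>t\<close> at the integers, a homeomorphism onto \<open>(0,\<infinity>)\<close>.\<close>

definition pl_exp :: "real \<Rightarrow> real" where
  "pl_exp t = 2 powi \<lfloor>t\<rfloor> * (1 + frac t)"

lemma pl_exp_shift: "pl_exp (t + of_int n) = 2 powi n * pl_exp t"
  by (simp add: pl_exp_def power_int_add frac_def)

lemma pl_exp_pos: "pl_exp t > 0"
  by (simp add: pl_exp_def add_pos_nonneg)

lemma pl_exp_0 [simp]: "pl_exp 0 = 1"
  by (simp add: pl_exp_def)

lemma pl_exp_eq:
  assumes "of_int j \<le> y" "y \<le> of_int j + 1"
  shows "pl_exp y = 2 powi j * y + 2 powi j * (1 - of_int j)"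
proof (cases "y = of_int j + 1")
  case True
  then show ?thesis by (simp add: pl_exp_def power_int_add frac_def algebra_simps)
next
  case False
  then have "\<lfloor>y\<rfloor> = j" using assms by linarith
  then show ?thesis by (simp add: pl_exp_def frac_def algebra_simps)
qed

lemma pl_at_pl_exp: "pl_at pl_exp x"
proof -
  have D: "2 powi j * (1 - of_int j) \<in> dyadic_rationals" for j
    using dyadic_rationals_mult[OF dyadic_rationals_powi dyadic_rationals_of_int[of "1 - j"]] by simp
  define j where "j = \<lfloor>x\<rfloor>"
  have j: "of_int j \<le> x" "x < of_int j + 1" by (simp_all add: j_def)
  show ?thesis
  proof (cases "x = of_int j")
    case True
    then show ?thesis
      by (intro pl_atI[of "of_int j - 1" x "of_int j + 1", OF _ _ D[of j] D[of "j - 1"] pl_exp_eq pl_exp_eq])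
        (auto simp: dyadic_rationals_of_int)
  next
    case False
    then show ?thesis using j
      by (intro pl_atI[of "of_int j" x "of_int j + 1", OF _ _ D[of j] D[of j] pl_exp_eq pl_exp_eq]) auto
  qed
qed

lemma pl_exp_less_iff: "pl_exp x < pl_exp y \<longleftrightarrow> x < y"
  using pl_strict_mono[OF pl_at_pl_exp] by (rule strict_mono_less)

lemma pl_exp_surj:
  assumes "y > 0"
  shows "\<exists>t. pl_exp t = y"
proof -
  define j where "j = \<lfloor>log 2 y\<rfloor>"
  have "2 powr (of_int j) \<le> y" "y < 2 powr (of_int j + 1)"
    using assms by (simp_all add: j_def powr_le_iff less_powr_iff)
  then have j: "2 powi j \<le> y" "y < 2 * 2 powi j"
    by (simp_all add: powr_add powr_real_of_int')
  define t where "t = of_int j + (y / 2 powi j - 1)"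
  have "0 \<le> y / 2 powi j - 1" "y / 2 powi j - 1 < 1"
    using j by (simp_all add: field_simps)
  then have "pl_exp t = 2 powi j * t + 2 powi j * (1 - of_int j)"
    by (intro pl_exp_eq) (simp_all add: t_def)
  then show ?thesis by (intro exI[of _ t]) (simp add: t_def field_simps)
qed

text \<open>A homeomorphism of the line onto \<open>(0,1)\<close> sending \<open>-k\<close> to \<open>2\<^sup>-\<^sup>k\<^sup>-\<^sup>1\<close> and \<open>k\<close> to \<open>1 - 2\<^sup>-\<^sup>k\<^sup>-\<^sup>1\<close> for
  \<open>k \<ge> 0\<close>. Integer translations near the ends of the line become scalings by
  powers of 2, centred at 0 and at 1.\<close>

definition to_unit :: "real \<Rightarrow> real" where
  "to_unit t = (if t \<le> 0 then pl_exp t / 2 else 1 - pl_exp (- t) / 2)"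

lemma to_unit_minus: "to_unit (- t) = 1 - to_unit t"
  by (simp add: to_unit_def)

lemma pl_at_to_unit: "pl_at to_unit x"
proof -
  have half: "pl_at (\<lambda>t. pl_exp t / 2) y" for y
    using pl_at_compose[OF pl_at_pl_exp pl_at_affine[of 0 "- 1"]] dyadic_rationals_of_int[of 0]
    by (simp add: comp_def power_int_minus)
  have one: "1 \<in> dyadic_rationals" using dyadic_rationals_of_int[of 1] by simp
  consider "x < 0" | "x > 0" | "x = 0" by linarith
  then show ?thesis
  proof cases
    case 1
    have "\<forall>\<^sub>F y in nhds x. to_unit y = pl_exp y / 2"
      using eventually_nhds_in_open[of "{..<0}" x] 1
      by (auto elim!: eventually_mono simp: to_unit_def)
    with half show ?thesis by (rule pl_at_cong)
  next
    case 2
    have "\<forall>\<^sub>F y in nhds x. to_unit y = 1 - pl_exp (- y) / 2"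
      using eventually_nhds_in_open[of "{0<..}" x] 2
      by (auto elim!: eventually_mono simp: to_unit_def)
    with pl_at_reflect[OF one half] show ?thesis by (rule pl_at_cong)
  next
    case 3
    have e: "pl_exp y = 1 + y / 2" if "- 1 \<le> y" "y \<le> 0" for y
      using pl_exp_eq[of "- 1" y] that by (simp add: power_int_minus field_simps)
    have c: "1 / 2 \<in> dyadic_rationals" using dyadic_rationals_powi[of "- 1"] by (simp add: power_int_minus)
    show ?thesis unfolding 3
      by (rule pl_atI[of "- 1" 0 1 "1 / 2" "1 / 2" _ "- 2" "- 2"])
        (auto simp: c to_unit_def e power_int_minus field_simps)
  qed
qed

lemma to_unit_less_iff: "to_unit x < to_unit y \<longleftrightarrow> x < y"
  using pl_strict_mono[OF pl_at_to_unit] by (rule strict_mono_less)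

lemma to_unit_bounds: "0 < to_unit t" "to_unit t < 1"
proof -
  have pos: "0 < to_unit t" for t
  proof (cases "t \<le> 0")
    case True
    then show ?thesis by (simp add: to_unit_def pl_exp_pos)
  next
    case False
    then have "pl_exp (- t) < pl_exp 0" by (simp only: pl_exp_less_iff)
    then show ?thesis using False by (simp add: to_unit_def)
  qed
  then show "0 < to_unit t" .
  show "to_unit t < 1" using pos[of "- t"] to_unit_minus[of t] by simp
qed

lemma to_unit_surj:
  assumes "0 < y" "y < 1"
  shows "\<exists>t. to_unit t = y"
proof -
  have small: "\<exists>t. to_unit t = y" if y: "0 < y" "y \<le> 1 / 2" for y
  proof -
    obtain t where t: "pl_exp t = 2 * y" using pl_exp_surj[of "2 * y"] y by auto
    then have "\<not> pl_exp 0 < pl_exp t" using y by simp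
    then have "t \<le> 0" by (simp only: pl_exp_less_iff)
    then show ?thesis using t by (intro exI[of _ t]) (simp add: to_unit_def)
  qed
  show ?thesis
  proof (cases "y \<le> 1 / 2")
    case True
    then show ?thesis using small assms by blast
  next
    case False
    then obtain t where "to_unit t = 1 - y" using small[of "1 - y"] assms by auto
    then show ?thesis using to_unit_minus[of t] by (intro exI[of _ "- t"]) simp
  qed
qed

lemma to_unit_shift:
  assumes "t \<le> 0" "t + of_int n \<le> 0"
  shows "to_unit (t + of_int n) = 2 powi n * to_unit t"
  using assms by (simp add: to_unit_def pl_exp_shift)

text \<open>The inverse of \<open>to_unit\<close>; its values outside \<open>(0,1)\<close> are irrelevant.\<close>

definition from_unit :: "real \<Rightarrow> real" where
  "from_unit = inv_into UNIV to_unit"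

lemma from_to_unit [simp]: "from_unit (to_unit t) = t"
  unfolding from_unit_def
  by (intro inv_f_f strict_mono_imp_inj_on pl_strict_mono pl_at_to_unit)

lemma to_from_unit: "0 < y \<Longrightarrow> y < 1 \<Longrightarrow> to_unit (from_unit y) = y"
  using to_unit_surj from_to_unit by metis

lemma pl_at_from_unit:
  assumes "0 < y" "y < 1"
  shows "pl_at from_unit y"
  using pl_at_inverse[OF pl_at_to_unit, of from_unit "from_unit y"] assms by (simp add: to_from_unit)


section \<open>Thompson's group in terms of germs\<close>

lemma affine_germ_at_end_points:
  assumes ab: "a < b" and f: "\<forall>y\<in>{a..b}. f y = 2 powi n * y + c"
  shows "affine_germ f n a (at_right a)" "affine_germ f n b (at_left b)"
proof -
  have eq: "f y = f x + 2 powi n * (y - x)" if "x \<in> {a..b}" "y \<in> {a..b}" for x y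
    using f[rule_format, OF that(1)] f[rule_format, OF that(2)] by (simp add: algebra_simps)
  show "affine_germ f n a (at_right a)"
    unfolding affine_germ_def eventually_at_right_field
    using ab by (intro exI[of _ b] conjI allI impI eq) auto
  show "affine_germ f n b (at_left b)"
    unfolding affine_germ_def eventually_at_left_field
    using ab by (intro exI[of _ a] conjI allI impI eq) auto
qed

lemma affine_germ_subinterval:
  assumes "\<forall>y\<in>{a..b}. f y = 2 powi n * y + c" "a < x" "x < b"
  shows "affine_germ f n x (at_right x)" "affine_germ f n x (at_left x)"
  using affine_germ_at_end_points(1)[of x b f n c] affine_germ_at_end_points(2)[of a x f n c] assms
  by auto

text \<open>Membership can be checked on germs: the interior ones keep the breakpoints dyadic, and the two at
  the ends prevent the breakpoints from accumulating there.\<close>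

lemma thompson_mapsI:
  assumes ext: "f \<in> extensional {0..1}" and f0: "f 0 = 0" and f1: "f 1 = 1"
    and pl: "\<And>x. 0 < x \<Longrightarrow> x < 1 \<Longrightarrow> pl_at f x"
    and g0: "affine_germ f n 0 (at_right 0)" and g1: "affine_germ f m 1 (at_left 1)"
  shows "f \<in> thompson_maps"
proof -
  have loc: "locally_affine 0 1 f"
  proof (rule locally_affineI)
    show "\<exists>n. affine_germ f n x (at_right x)" if "0 \<le> x" "x < 1" for x
      using that g0 pl[of x] unfolding pl_at_def by (cases "x = 0") auto
    show "\<exists>n. affine_germ f n x (at_left x)" if "0 < x" "x \<le> 1" for x
      using that g1 pl[of x] unfolding pl_at_def by (cases "x = 1") auto
  qed
  have mono: "strict_mono_on {0..1} f"
    by (rule strict_mono_onI) (use locally_affine_less[OF loc] in auto)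
  have le: "f x \<le> f y" if "x \<in> {0..1}" "y \<in> {0..1}" "x \<le> y" for x y
    using strict_mono_onD[OF mono that(1,2)] that(3) by (cases "x = y") auto
  have cont: "continuous_on {0..1} f" using loc by (rule locally_affine_continuous_on)
  have "f ` {0..1} = {0..1}"
  proof
    show "f ` {0..1} \<subseteq> {0..1}"
      using le[of 0] le[of _ 1] f0 f1 by fastforce
    show "{0..1} \<subseteq> f ` {0..1}"
    proof
      fix y :: real assume "y \<in> {0..1}"
      then obtain x where "0 \<le> x" "x \<le> 1" "f x = y" using IVT'[of f 0 y 1] cont f0 f1 by auto
      then show "y \<in> f ` {0..1}" by auto
    qed
  qed
  then have hom: "\<exists>g. homeomorphism {0..1} {0..1} f g"
    using homeomorphism_compact[OF compact_Icc cont] strict_mono_on_imp_inj_on[OF mono] by blast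
  obtain B where B: "finite B" "dyadic_linear_off B f"
    using locally_affine_finite_breaks[OF loc] unfolding dyadic_linear_off_def by auto
  have dyadic: "x \<in> dyadic_rationals \<and> f x \<in> dyadic_rationals" if x: "x \<in> breakpoints f" for x
  proof -
    have x01: "0 < x" "x < 1" using x by (auto simp: breakpoints_def)
    note plx = pl[OF this]
    have "x \<in> dyadic_rationals"
    proof (rule ccontr)
      assume "x \<notin> dyadic_rationals"
      then obtain n where n: "affine_germ f n x (at_right x)" "affine_germ f n x (at_left x)"
        using plx unfolding pl_at_def by blast
      obtain d where d: "d > 0" "\<forall>y. x < y \<and> y < x + d \<longrightarrow> f y = f x + 2 powi n * (y - x)"
        using n(1) unfolding affine_germ_at_right_iff by blast
      obtain e where e: "e > 0" "\<forall>y. x - e < y \<and> y < x \<longrightarrow> f y = f x + 2 powi n * (y - x)"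
        using n(2) unfolding affine_germ_at_left_iff by blast
      have "f y = 2 powi n * y + (f x - 2 powi n * x)" if "y \<in> {x - min d e<..<x + min d e}" for y
      proof -
        have "x - e < y" "y < x + d" using that by (auto simp: min_def split: if_splits)
        then show ?thesis
          using d(2)[rule_format, of y] e(2)[rule_format, of y]
          by (cases y x rule: linorder_cases) (simp_all add: algebra_simps)
      qed
      then have "\<forall>y\<in>{x - min d e<..<x + min d e} \<inter> {0..1}. f y = 2 powi n * y + (f x - 2 powi n * x)"
        by blast
      moreover have "min d e > 0" using d(1) e(1) by simp
      ultimately have "\<exists>e>0. \<exists>s c. \<forall>y\<in>{x - e<..<x + e} \<inter> {0..1}. f y = s * y + c"
        by blast
      then show False using x unfolding breakpoints_def by blast
    qed
    then show ?thesis using plx unfolding pl_at_def by blast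
  qed
  have "finite (breakpoints f)" using breakpoints_subset[OF B] B(1) finite_subset by blast
  with ext hom mono dyadic dyadic_linear_off_breakpoints[OF B] show ?thesis
    unfolding thompson_maps_def dyadic_linear_off_def by blast
qed

lemma thompson_maps_1:
  assumes "f \<in> thompson_maps"
  shows "f 1 = 1"
proof -
  note im = thompson_maps_image_interval[OF assms, of 0 1]
  have "f ` {0..1} = {0..1}"
    using assms by (auto simp: thompson_maps_def homeomorphism_def)
  then have "{f 0..f 1} = {0..1}" using im(1) by simp
  then show ?thesis using im(4) by (simp add: Icc_eq_Icc)
qed

lemma thompson_maps_dyadic_iff:
  assumes f: "f \<in> thompson_maps" and x: "x \<in> {0..1}"
  shows "x \<in> dyadic_rationals \<longleftrightarrow> f x \<in> dyadic_rationals"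
proof
  assume *: "f x \<in> dyadic_rationals"
  have "bij_betw f {0..1} {0..1}" using thompson_maps_bij[OF f] by (simp add: Bij_def)
  then have fx: "f x \<in> {0..1}" "inv_into {0..1} f (f x) = x"
    using x bij_betwE bij_betw_inv_into_left by (blast, metis)
  show "x \<in> dyadic_rationals"
    using thompson_maps_dyadic[OF thompson_maps_inverse[OF f] fx(1) *] fx by simp
qed (use thompson_maps_dyadic[OF f x] in blast)

lemma thompson_maps_germs:
  assumes f: "f \<in> thompson_maps"
  shows "\<And>x. 0 < x \<Longrightarrow> x < 1 \<Longrightarrow> pl_at f x"
    and "\<exists>n. affine_germ f n 0 (at_right 0)" "\<exists>m. affine_germ f m 1 (at_left 1)"
proof -
  obtain B where B: "finite B" "B \<subseteq> {0..1}" "B \<subseteq> dyadic_rationals" "dyadic_linear_off B f"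
    using f unfolding thompson_maps_iff by blast
  have off: "\<exists>(n::int) c. \<forall>x\<in>{a..b}. f x = 2 powi n * x + c"
    if "0 \<le> a" "a < b" "b \<le> 1" "{a<..<b} \<inter> B = {}" for a b
    using B(4) that unfolding dyadic_linear_off_def by blast
  have gap: "\<exists>d>0. {x - d<..<x} \<inter> B = {} \<and> {x<..<x + d} \<inter> B = {}" for x
  proof -
    obtain d where "d > 0" "\<forall>y\<in>B. y \<noteq> x \<longrightarrow> d \<le> dist x y"
      using finite_set_avoid[OF B(1), of x] by metis
    then show ?thesis by (intro exI[of _ d]) (force simp: dist_real_def)
  qed
  have right: "\<exists>n. affine_germ f n x (at_right x)" if x: "0 \<le> x" "x < 1" for x
  proof -
    obtain d where d: "d > 0" "{x<..<x + d} \<inter> B = {}" using gap by blast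
    have "{x<..<min (x + d) 1} \<inter> B = {}" using d(2) by auto
    then obtain n :: int and c where n: "\<forall>y\<in>{x..min (x + d) 1}. f y = 2 powi n * y + c"
      using off[of x "min (x + d) 1"] x d(1) by auto
    show ?thesis using affine_germ_at_end_points(1)[OF _ n] x d(1) by auto
  qed
  have left: "\<exists>n. affine_germ f n x (at_left x)" if x: "0 < x" "x \<le> 1" for x
  proof -
    obtain d where d: "d > 0" "{x - d<..<x} \<inter> B = {}" using gap by blast
    have "{max (x - d) 0<..<x} \<inter> B = {}" using d(2) by auto
    then obtain n :: int and c where n: "\<forall>y\<in>{max (x - d) 0..x}. f y = 2 powi n * y + c"
      using off[of "max (x - d) 0" x] x d(1) by auto
    show ?thesis using affine_germ_at_end_points(2)[OF _ n] x d(1) by auto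
  qed
  show "\<exists>n. affine_germ f n 0 (at_right 0)" "\<exists>m. affine_germ f m 1 (at_left 1)"
    using right[of 0] left[of 1] by auto
  fix x :: real assume x: "0 < x" "x < 1"
  have "\<exists>n m. affine_germ f n x (at_right x) \<and> affine_germ f m x (at_left x) \<and>
        (x \<in> dyadic_rationals \<or> n = m)"
  proof (cases "x \<in> B")
    case True
    then show ?thesis using left[of x] right[of x] x B(3) by auto
  next
    case False
    obtain d where d: "d > 0" "{x - d<..<x} \<inter> B = {}" "{x<..<x + d} \<inter> B = {}" using gap by blast
    define a b where "a = max (x - d) 0" and "b = min (x + d) 1"
    have ab: "0 \<le> a" "a < x" "x < b" "b \<le> 1" using d(1) x by (auto simp: a_def b_def)
    have "y \<notin> B" if "y \<in> {a<..<b}" for y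
    proof -
      have "y \<in> {x - d<..<x} \<or> y = x \<or> y \<in> {x<..<x + d}" using that by (auto simp: a_def b_def)
      then show ?thesis using d False by blast
    qed
    then have "{a<..<b} \<inter> B = {}" by blast
    then obtain n :: int and c where "\<forall>x\<in>{a..b}. f x = 2 powi n * x + c"
      using off[of a b] ab by auto
    then show ?thesis using affine_germ_subinterval ab by blast
  qed
  then show "pl_at f x"
    using thompson_maps_dyadic_iff[OF f, of x] x unfolding pl_at_def by auto
qed

section \<open>Thompson's group on the real line\<close>

text \<open>The map of \<open>[0,1]\<close> that corresponds to the map \<open>u\<close> of the line in the coordinate \<open>to_unit\<close> and
  fixes both end points, as an extensional function.\<close>

definition unit_conj :: "(real \<Rightarrow> real) \<Rightarrow> real \<Rightarrow> real" where
  "unit_conj u = (\<lambda>x\<in>{0..1}. if x = 0 \<or> x = 1 then x else to_unit (u (from_unit x)))"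

lemma unit_conj_simps [simp]:
  "unit_conj u 0 = 0" "unit_conj u 1 = 1" "unit_conj u (to_unit t) = to_unit (u t)"
  using to_unit_bounds[of t] by (auto simp: unit_conj_def less_imp_le)

lemma unit_conj_extensional: "unit_conj u \<in> extensional {0..1}"
  by (simp add: unit_conj_def)

lemma unit_interval_cases:
  assumes "x \<in> {0..1}"
  obtains "x = 0" | "x = 1" | t where "x = to_unit t"
  using assms to_unit_surj[of x] by (metis atLeastAtMost_iff less_eq_real_def)

lemma to_unit_in [simp]: "to_unit t \<in> {0..1}"
  using to_unit_bounds[of t] by simp

lemma unit_conj_compose: "unit_conj (u \<circ> v) = compose {0..1} (unit_conj u) (unit_conj v)"
proof (rule extensionalityI[OF unit_conj_extensional compose_extensional])
  fix x :: real assume "x \<in> {0..1}"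
  then show "unit_conj (u \<circ> v) x = compose {0..1} (unit_conj u) (unit_conj v) x"
    by (cases rule: unit_interval_cases) (simp_all add: compose_def del: atLeastAtMost_iff, simp_all)
qed

lemma unit_conj_Bij:
  assumes "bij u"
  shows "unit_conj u \<in> Bij {0..1}"
proof -
  have maps: "unit_conj v x \<in> {0..1}" if "x \<in> {0..1}" for v x
    using that by (cases rule: unit_interval_cases) (simp_all del: atLeastAtMost_iff, simp_all)
  have inverse: "unit_conj v (unit_conj w x) = x" if "\<And>t. v (w t) = t" "x \<in> {0..1}" for v w x
    using that(2) by (cases rule: unit_interval_cases) (simp_all add: that(1))
  have "bij_betw (unit_conj u) {0..1} {0..1}"
    by (rule bij_betw_byWitness[where f' = "unit_conj (inv_into UNIV u)"])
      (use maps inverse assms in \<open>auto simp: bij_def surj_f_inv_f image_subset_iff simp del: atLeastAtMost_iff\<close>)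
  then show ?thesis by (simp add: Bij_def unit_conj_extensional)
qed

lemma Bij_UNIV: "Bij (UNIV :: 'a set) = {u. bij u}"
  by (auto simp: Bij_def extensional_def)

lemma unit_conj_hom: "unit_conj \<in> hom (BijGroup UNIV) (BijGroup {0..1})"
proof (rule homI)
  show "unit_conj u \<in> carrier (BijGroup {0..1})" if "u \<in> carrier (BijGroup UNIV)" for u
    using that by (simp add: BijGroup_def Bij_UNIV unit_conj_Bij)
  show "unit_conj (u \<otimes>\<^bsub>BijGroup UNIV\<^esub> v) = unit_conj u \<otimes>\<^bsub>BijGroup {0..1}\<^esub> unit_conj v"
    if "u \<in> carrier (BijGroup UNIV)" "v \<in> carrier (BijGroup UNIV)" for u v
    using that unit_conj_compose[of u v]
    by (simp add: BijGroup_def Bij_UNIV unit_conj_Bij compose_def comp_def restrict_UNIV)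
qed

lemma unit_conj_inject:
  assumes "unit_conj u = unit_conj v"
  shows "u = v"
proof
  fix t
  have "to_unit (u t) = to_unit (v t)" using assms unit_conj_simps(3) by metis
  then show "u t = v t" using from_to_unit by metis
qed

text \<open>Thompson's group in the coordinate on the line. A single element may have breakpoints only in a
  compact interval, because it is a translation by an integer near each end.\<close>

definition thompson_line :: "(real \<Rightarrow> real) set" where
  "thompson_line = {u. pl_homeo u \<and> (\<exists>(n::int) N. \<forall>t\<le>N. u t = t + of_int n) \<and>
     (\<exists>(m::int) N. \<forall>t\<ge>N. u t = t + of_int m)}"

lemma unit_conj_thompson_line:
  assumes "u \<in> thompson_line"
  shows "unit_conj u \<in> thompson_maps"
proof -
  obtain n m :: int and N M where u: "pl_homeo u" and n: "\<And>t. t \<le> N \<Longrightarrow> u t = t + of_int n"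
    and m: "\<And>t. t \<ge> M \<Longrightarrow> u t = t + of_int m"
    using assms unfolding thompson_line_def by blast
  \<comment> \<open>to the left of \<open>N'\<close> the shift by \<open>n\<close> stays on the negative half-line, where it becomes a scaling\<close>
  define N' where "N' = min N (min 0 (- of_int n))"
  define M' where "M' = max M (max 0 (- of_int m))"
  have "unit_conj u y = 2 powi n * y" if y: "0 < y" "y < to_unit N'" for y
  proof -
    obtain t where t: "y = to_unit t" using to_unit_surj[of y] y to_unit_bounds(2)[of N'] by fastforce
    then have "t < N'" using y by (simp add: to_unit_less_iff)
    then have "t \<le> N" "t \<le> 0" "t + of_int n \<le> 0" by (auto simp: N'_def)
    then show ?thesis using n[of t] to_unit_shift[of t n] t by simp
  qed
  then have g0: "affine_germ (unit_conj u) n 0 (at_right 0)"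
    unfolding affine_germ_def eventually_at_right_field
    using to_unit_bounds(1)[of N'] by (intro exI[of _ "to_unit N'"]) simp
  have "unit_conj u y = 1 + 2 powi (- m) * (y - 1)" if y: "to_unit M' < y" "y < 1" for y
  proof -
    obtain t where t: "y = to_unit t" using to_unit_surj[of y] y to_unit_bounds(1)[of M'] by fastforce
    then have "M' < t" using y by (simp add: to_unit_less_iff)
    then have *: "M \<le> t" "- t \<le> 0" "- t + of_int (- m) \<le> 0" by (auto simp: M'_def)
    have "to_unit (- (t + of_int m)) = 2 powi (- m) * to_unit (- t)"
      using to_unit_shift[OF *(2,3)] by simp
    then have "1 - to_unit (t + of_int m) = 2 powi (- m) * (1 - to_unit t)"
      by (simp only: to_unit_minus)
    then show ?thesis using m[OF *(1)] t by (simp add: algebra_simps)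
  qed
  then have g1: "affine_germ (unit_conj u) (- m) 1 (at_left 1)"
    unfolding affine_germ_def eventually_at_left_field
    using to_unit_bounds(2)[of M'] by (intro exI[of _ "to_unit M'"]) simp
  have pl: "pl_at (unit_conj u) x" if x: "0 < x" "x < 1" for x
  proof (rule pl_at_cong)
    show "pl_at (to_unit \<circ> (u \<circ> from_unit)) x"
      using u x by (intro pl_at_compose pl_at_to_unit pl_at_from_unit) (simp_all add: pl_homeo_def)
    show "\<forall>\<^sub>F y in nhds x. unit_conj u y = (to_unit \<circ> (u \<circ> from_unit)) y"
      using eventually_nhds_in_open[of "{0<..<1}" x] x
      by (auto elim!: eventually_mono simp: unit_conj_def)
  qed
  show ?thesis
    using thompson_mapsI[OF unit_conj_extensional unit_conj_simps(1,2) pl g0 g1] .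
qed

lemma thompson_maps_unit_conj:
  assumes f: "f \<in> thompson_maps"
  obtains u where "u \<in> thompson_line" "f = unit_conj u"
proof -
  define u where "u t = from_unit (f (to_unit t))" for t
  have img: "f ` {0<..<1} = {0<..<1}"
    using thompson_maps_image_interval(2)[OF f, of 0 1] thompson_maps_0[OF f] thompson_maps_1[OF f]
    by simp
  have f_to_unit: "0 < f (to_unit t)" "f (to_unit t) < 1" for t
  proof -
    have "f (to_unit t) \<in> f ` {0<..<1}" using to_unit_bounds by (intro imageI) simp
    then show "0 < f (to_unit t)" "f (to_unit t) < 1" unfolding img by simp_all
  qed
  have to_unit_u: "to_unit (u t) = f (to_unit t)" for t
    unfolding u_def by (rule to_from_unit[OF f_to_unit])
  have "surj u"
  proof -
    have "t \<in> range u" for t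
    proof -
      have "to_unit t \<in> f ` {0<..<1}" using img to_unit_bounds[of t] by auto
      then obtain x where x: "0 < x" "x < 1" "f x = to_unit t" by auto
      then have "u (from_unit x) = t" by (simp add: u_def to_from_unit)
      then show ?thesis by blast
    qed
    then show ?thesis by blast
  qed
  moreover have "pl_at u t" for t
  proof -
    have "pl_at (from_unit \<circ> (f \<circ> to_unit)) t"
      using to_unit_bounds f_to_unit
      by (intro pl_at_compose pl_at_to_unit pl_at_from_unit thompson_maps_germs(1)[OF f]) simp_all
    moreover have "from_unit \<circ> (f \<circ> to_unit) = u" by (simp add: fun_eq_iff u_def)
    ultimately show ?thesis by simp
  qed
  ultimately have u: "pl_homeo u" by (simp add: pl_homeo_def)
  obtain n d where d: "d > 0" "\<forall>y. 0 < y \<and> y < 0 + d \<longrightarrow> f y = f 0 + 2 powi n * (y - 0)"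
    using thompson_maps_germs(2)[OF f] unfolding affine_germ_at_right_iff by blast
  obtain m e where e: "e > 0" "\<forall>y. 1 - e < y \<and> y < 1 \<longrightarrow> f y = f 1 + 2 powi m * (y - 1)"
    using thompson_maps_germs(3)[OF f] unfolding affine_germ_at_left_iff by blast
  have small: "\<exists>N. \<forall>t\<le>N. to_unit t < c \<and> t \<le> 0 \<and> t + of_int k \<le> 0" if "c > 0" for c k
  proof -
    define t0 where "t0 = from_unit (min c (1 / 2))"
    have t0: "to_unit t0 \<le> c" using that by (simp add: t0_def to_from_unit)
    show ?thesis
    proof (intro exI[of _ "min (t0 - 1) (min 0 (- of_int k))"] allI impI)
      fix t assume *: "t \<le> min (t0 - 1) (min 0 (- real_of_int k))"
      then have "to_unit t < to_unit t0" by (simp add: to_unit_less_iff)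
      then show "to_unit t < c \<and> t \<le> 0 \<and> t + of_int k \<le> 0" using t0 * by auto
    qed
  qed
  obtain N where N: "\<And>t. t \<le> N \<Longrightarrow> to_unit t < d \<and> t \<le> 0 \<and> t + of_int n \<le> 0"
    using small[OF d(1)] by blast
  have "u t = t + of_int n" if "t \<le> N" for t
  proof -
    have "f (to_unit t) = to_unit (t + of_int n)"
      using d(2)[rule_format, of "to_unit t"] N[OF that] to_unit_bounds[of t] thompson_maps_0[OF f]
      by (simp add: to_unit_shift)
    then show ?thesis by (simp add: u_def)
  qed
  moreover obtain M where M: "\<And>t. t \<le> M \<Longrightarrow> to_unit t < e \<and> t \<le> 0 \<and> t + of_int m \<le> 0"
    using small[OF e(1)] by blast
  have "u t = t + of_int (- m)" if "- M \<le> t" for t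
  proof -
    have *: "to_unit (- t) < e" "- t \<le> 0" "- t + of_int m \<le> 0" using M[of "- t"] that by auto
    have "f (to_unit t) = 1 - 2 powi m * to_unit (- t)"
      using e(2)[rule_format, of "to_unit t"] *(1) to_unit_bounds[of t] thompson_maps_1[OF f]
      by (simp add: to_unit_minus algebra_simps)
    also have "\<dots> = to_unit (- (- t + of_int m))"
      unfolding to_unit_minus to_unit_shift[OF *(2,3)] by (simp add: to_unit_minus)
    finally show ?thesis by (simp add: u_def)
  qed
  ultimately have "u \<in> thompson_line" using u unfolding thompson_line_def by blast
  moreover have "f = unit_conj u"
  proof (rule extensionalityI[OF _ unit_conj_extensional])
    show "f \<in> extensional {0..1}" using f by (simp add: thompson_maps_def)
    fix x :: real assume "x \<in> {0..1}"
    then show "f x = unit_conj u x"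
      using thompson_maps_0[OF f] thompson_maps_1[OF f] to_unit_u
      by (cases rule: unit_interval_cases) simp_all
  qed
  ultimately show ?thesis by (rule that)
qed

text \<open>Near either end \<open>u\<close> is an integer translation, with which \<open>g\<close> commutes.\<close>

lemma thompson_line_conj:
  assumes u: "u \<in> thompson_line" and g: "pl_homeo g" and shift: "\<And>t. g (t + 1) = g t + 1"
  shows "g \<circ> u \<circ> inv_into UNIV g \<in> thompson_line"
proof -
  obtain n m :: int and N M where u': "pl_homeo u" and n: "\<And>t. t \<le> N \<Longrightarrow> u t = t + of_int n"
    and m: "\<And>t. t \<ge> M \<Longrightarrow> u t = t + of_int m"
    using u unfolding thompson_line_def by blast
  have int: "g (t + of_int j) = g t + of_int j" for t j
    using shift_int[of g 1 t j] shift by simp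
  define h where "h = inv_into UNIV g"
  have h: "g (h t) = t" for t using g by (simp add: h_def)
  have hle: "h t \<le> N" if "t \<le> g N" for t N
    using pl_homeo_le_iff[OF g, of "h t" N] that by (simp add: h)
  have hge: "N \<le> h t" if "g N \<le> t" for t N
    using pl_homeo_le_iff[OF g, of N "h t"] that by (simp add: h)
  have "(g \<circ> u \<circ> h) t = t + of_int n" if "t \<le> g N" for t
    using n[OF hle[OF that]] by (simp add: int h)
  moreover have "(g \<circ> u \<circ> h) t = t + of_int m" if "g M \<le> t" for t
    using m[OF hge[OF that]] by (simp add: int h)
  moreover have "pl_homeo (g \<circ> u \<circ> h)"
    unfolding h_def by (intro pl_homeo_compose g u' pl_homeo_inv)
  ultimately show ?thesis unfolding thompson_line_def h_def by blast
qed

lemma ex_thompson_line_fixing_half_line: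
  "\<exists>u\<in>thompson_line. \<forall>t. u t = t \<longleftrightarrow> t \<le> 0"
proof
  define u :: "real \<Rightarrow> real" where "u t = max t (min (2 * t) (t + 1))" for t
  have D: "real_of_int k \<in> dyadic_rationals" for k by (rule dyadic_rationals_of_int)
  have "pl_at u x" for x
  proof -
    consider "x < 0" | "x = 0" | "0 < x" "x < 1" | "x = 1" | "1 < x" by linarith
    then show ?thesis
    proof cases
      case 1
      then show ?thesis
        by (intro pl_atI[of "x - 1" x 0, OF _ _ D[of 0] D[of 0], of _ 0 0]) (auto simp: u_def)
    next
      case 2
      then show ?thesis using D[of 0]
        by (intro pl_atI[of "- 1" x 1, OF _ _ D[of 0] D[of 0], of _ 1 0]) (auto simp: u_def)
    next
      case 3
      then show ?thesis
        by (intro pl_atI[of 0 x 1, OF _ _ D[of 0] D[of 0], of _ 1 1]) (auto simp: u_def)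
    next
      case 4
      then show ?thesis using D[of 1]
        by (intro pl_atI[of 0 x 2, OF _ _ D[of 1] D[of 0], of _ 0 1]) (auto simp: u_def)
    next
      case 5
      then show ?thesis
        by (intro pl_atI[of 1 x "x + 1", OF _ _ D[of 1] D[of 1], of _ 0 0]) (auto simp: u_def)
    qed
  qed
  moreover have "surj u"
  proof (rule pl_surj)
    show "\<exists>x. u x \<le> M" for M by (intro exI[of _ "min M 0"]) (auto simp: u_def)
    show "\<exists>x. M \<le> u x" for M by (intro exI[of _ M]) (auto simp: u_def)
  qed fact
  moreover have "\<forall>t\<le>0. u t = t + of_int 0" "\<forall>t\<ge>1. u t = t + of_int 1"
    by (auto simp: u_def)
  ultimately show "u \<in> thompson_line" unfolding thompson_line_def pl_homeo_def by blast
  show "\<forall>t. u t = t \<longleftrightarrow> t \<le> 0" by (auto simp: u_def max_def min_def)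
qed

section \<open>Automorphisms by conjugation\<close>

text \<open>A homomorphism into a group \<open>K\<close> whose values normalise a subgroup \<open>S\<close> induces an action on \<open>S\<close>
  by automorphisms. One inclusion \<open>\<rho> q S (\<rho> q)\<inverse> \<subseteq> S\<close> suffices, as it is assumed for all \<open>q\<close>.\<close>

lemma conj_hom_AutoGroup:
  fixes K :: "('a, 'b) monoid_scheme"
  assumes Q: "group Q" and K: "group K" and S: "subgroup S K" and \<rho>: "\<rho> \<in> hom Q K"
    and conj: "\<And>q s. q \<in> carrier Q \<Longrightarrow> s \<in> S \<Longrightarrow> \<rho> q \<otimes>\<^bsub>K\<^esub> s \<otimes>\<^bsub>K\<^esub> inv\<^bsub>K\<^esub> (\<rho> q) \<in> S"
  shows "(\<lambda>q. \<lambda>s\<in>S. \<rho> q \<otimes>\<^bsub>K\<^esub> s \<otimes>\<^bsub>K\<^esub> inv\<^bsub>K\<^esub> (\<rho> q)) \<in> hom Q (AutoGroup (K\<lparr>carrier := S\<rparr>))"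
    (is "?\<Theta> \<in> _")
proof -
  interpret K: group K by (rule K)
  interpret \<rho>: group_hom Q K \<rho> using Q K \<rho> by (simp add: group_hom_def group_hom_axioms_def)
  have SK: "s \<in> carrier K" if "s \<in> S" for s using that subgroup.subset[OF S] by blast
  have closed: "?\<Theta> q s \<in> S" if "q \<in> carrier Q" "s \<in> S" for q s
    using conj that by simp
  have mult: "?\<Theta> (q \<otimes>\<^bsub>Q\<^esub> r) s = ?\<Theta> q (?\<Theta> r s)"
    if "q \<in> carrier Q" "r \<in> carrier Q" "s \<in> S" for q r s
    using that conj[of r s] SK[of s]
    by (simp add: K.inv_mult_group K.m_assoc)
  have one: "?\<Theta> \<one>\<^bsub>Q\<^esub> s = s" if "s \<in> S" for s
    using that SK[of s] by simp
  have auto: "?\<Theta> q \<in> auto (K\<lparr>carrier := S\<rparr>)" if q: "q \<in> carrier Q" for q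
  proof -
    have "?\<Theta> q (s \<otimes>\<^bsub>K\<^esub> t) = ?\<Theta> q s \<otimes>\<^bsub>K\<^esub> ?\<Theta> q t" if "s \<in> S" "t \<in> S" for s t
    proof -
      have "inv\<^bsub>K\<^esub> (\<rho> q) \<otimes>\<^bsub>K\<^esub> (\<rho> q \<otimes>\<^bsub>K\<^esub> (t \<otimes>\<^bsub>K\<^esub> inv\<^bsub>K\<^esub> (\<rho> q))) = t \<otimes>\<^bsub>K\<^esub> inv\<^bsub>K\<^esub> (\<rho> q)"
        using q SK[OF that(2)] by (simp flip: K.m_assoc)
      then show ?thesis
        using q that SK subgroup.m_closed[OF S that] by (simp add: K.m_assoc)
    qed
    then have "?\<Theta> q \<in> hom (K\<lparr>carrier := S\<rparr>) (K\<lparr>carrier := S\<rparr>)"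
      using closed[OF q] by (intro homI) simp_all
    moreover have "bij_betw (?\<Theta> q) S S"
    proof (rule bij_betw_byWitness[where f' = "?\<Theta> (inv\<^bsub>Q\<^esub> q)"])
      show "\<forall>s\<in>S. ?\<Theta> (inv\<^bsub>Q\<^esub> q) (?\<Theta> q s) = s" "\<forall>s\<in>S. ?\<Theta> q (?\<Theta> (inv\<^bsub>Q\<^esub> q) s) = s"
        using mult[of "inv\<^bsub>Q\<^esub> q" q] mult[of q "inv\<^bsub>Q\<^esub> q"] one q by (simp_all del: restrict_apply)
      show "?\<Theta> q ` S \<subseteq> S" "?\<Theta> (inv\<^bsub>Q\<^esub> q) ` S \<subseteq> S"
        by (intro image_subsetI closed; use q in simp)+
    qed
    ultimately show ?thesis unfolding auto_def Bij_def by simp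
  qed
  then have Bij: "?\<Theta> q \<in> Bij S" if "q \<in> carrier Q" for q
    using that unfolding auto_def by auto
  show ?thesis
  proof (rule homI)
    show "?\<Theta> q \<in> carrier (AutoGroup (K\<lparr>carrier := S\<rparr>))" if "q \<in> carrier Q" for q
      using auto[OF that] by (simp add: AutoGroup_def)
    show "?\<Theta> (q \<otimes>\<^bsub>Q\<^esub> r) = ?\<Theta> q \<otimes>\<^bsub>AutoGroup (K\<lparr>carrier := S\<rparr>)\<^esub> ?\<Theta> r"
      if qr: "q \<in> carrier Q" "r \<in> carrier Q" for q r
    proof -
      have "?\<Theta> (q \<otimes>\<^bsub>Q\<^esub> r) = compose S (?\<Theta> q) (?\<Theta> r)"
      proof (rule extensionalityI[OF restrict_extensional compose_extensional])
        show "?\<Theta> (q \<otimes>\<^bsub>Q\<^esub> r) s = compose S (?\<Theta> q) (?\<Theta> r) s" if "s \<in> S" for s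
          using mult[OF qr that] by (simp only: compose_eq[OF that])
      qed
      then show ?thesis using Bij qr by (simp add: AutoGroup_def BijGroup_def)
    qed
  qed
qed

lemma rat_flow_hom: "rat_flow \<in> hom rat_group (BijGroup UNIV)"
proof (rule homI)
  show "rat_flow r \<in> carrier (BijGroup UNIV)" for r
    by (simp add: BijGroup_def Bij_UNIV pl_homeo_bij rat_flow_pl_homeo)
  show "rat_flow (r \<otimes>\<^bsub>rat_group\<^esub> s) = rat_flow r \<otimes>\<^bsub>BijGroup UNIV\<^esub> rat_flow s" for r s
    by (rule ext)
      (simp add: BijGroup_def Bij_UNIV pl_homeo_bij rat_flow_pl_homeo rat_group_def rat_flow_add compose_def)
qed

lemma unit_conj_rat_flow_conj:
  assumes u: "pl_homeo u"
  shows "unit_conj (rat_flow r) \<otimes>\<^bsub>BijGroup {0..1}\<^esub> unit_conj u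
      \<otimes>\<^bsub>BijGroup {0..1}\<^esub> inv\<^bsub>BijGroup {0..1}\<^esub> unit_conj (rat_flow r) =
    unit_conj (rat_flow r \<circ> u \<circ> inv_into UNIV (rat_flow r))"
proof -
  interpret group_hom "BijGroup UNIV" "BijGroup {0..1}" unit_conj
    using unit_conj_hom by (simp add: group_hom_def group_hom_axioms_def group_BijGroup)
  let ?g = "rat_flow r"
  have c: "?g \<in> carrier (BijGroup UNIV)" "u \<in> carrier (BijGroup UNIV)"
    using u by (simp_all add: BijGroup_def Bij_UNIV pl_homeo_bij rat_flow_pl_homeo)
  have "bij u" "bij ?g" "bij (inv_into UNIV ?g)"
    using u by (simp_all add: pl_homeo_bij rat_flow_pl_homeo pl_homeo_inv)
  then have "?g \<otimes>\<^bsub>BijGroup UNIV\<^esub> u \<otimes>\<^bsub>BijGroup UNIV\<^esub> inv\<^bsub>BijGroup UNIV\<^esub> ?g = ?g \<circ> u \<circ> inv_into UNIV ?g"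
    by (simp add: inv_BijGroup Bij_UNIV)
      (simp add: BijGroup_def Bij_UNIV compose_def fun_eq_iff bij_comp[unfolded comp_def])
  then show ?thesis using c by (metis G.inv_closed G.m_closed hom_inv hom_mult)
qed

theorem corollary2:
  shows "\<exists>H. subgroup H (AutoGroup thompson_F) \<and>
             (AutoGroup thompson_F)\<lparr>carrier := H\<rparr> \<cong> rat_group"
proof -
  define K where "K = BijGroup {0..1::real}"
  define \<rho> where "\<rho> = unit_conj \<circ> rat_flow"
  define \<Theta> where "\<Theta> r = (\<lambda>f\<in>thompson_maps. \<rho> r \<otimes>\<^bsub>K\<^esub> f \<otimes>\<^bsub>K\<^esub> inv\<^bsub>K\<^esub> (\<rho> r))" for r
  have \<rho>: "\<rho> \<in> hom rat_group K"
    unfolding \<rho>_def K_def by (rule hom_compose[OF rat_flow_hom unit_conj_hom])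
  have conj: "\<rho> r \<otimes>\<^bsub>K\<^esub> unit_conj u \<otimes>\<^bsub>K\<^esub> inv\<^bsub>K\<^esub> (\<rho> r) =
      unit_conj (rat_flow r \<circ> u \<circ> inv_into UNIV (rat_flow r))" if "u \<in> thompson_line" for r u
    using that unit_conj_rat_flow_conj[of u r] by (simp add: \<rho>_def K_def thompson_line_def)
  have "\<Theta> \<in> hom rat_group (AutoGroup (K\<lparr>carrier := thompson_maps\<rparr>))"
    unfolding \<Theta>_def
  proof (rule conj_hom_AutoGroup[OF group_rat_group _ _ \<rho>])
    show "\<rho> r \<otimes>\<^bsub>K\<^esub> f \<otimes>\<^bsub>K\<^esub> inv\<^bsub>K\<^esub> (\<rho> r) \<in> thompson_maps" if "f \<in> thompson_maps" for r f
    proof -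
      obtain u where u: "u \<in> thompson_line" "f = unit_conj u"
        using \<open>f \<in> thompson_maps\<close> by (rule thompson_maps_unit_conj)
      show ?thesis
        using unit_conj_thompson_line[OF thompson_line_conj[OF u(1) rat_flow_pl_homeo rat_flow_shift]]
          conj[OF u(1)] u(2) by simp
    qed
  qed (simp_all add: K_def group_BijGroup subgroup_thompson_maps)
  then have \<Theta>: "\<Theta> \<in> hom rat_group (AutoGroup thompson_F)"
    by (simp add: K_def thompson_F_def)
  interpret F: group thompson_F by (rule group_thompson_F)
  interpret A: group "AutoGroup thompson_F" by (rule F.AutoGroup)
  interpret \<Theta>: group_hom rat_group "AutoGroup thompson_F" \<Theta>
    using \<Theta> group_rat_group A.group_axioms by (simp add: group_hom_def group_hom_axioms_def)
  have ker: "r = 0" if r: "\<Theta> r = \<one>\<^bsub>AutoGroup thompson_F\<^esub>" for r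
  proof -
    obtain u where u: "u \<in> thompson_line" "\<And>t. u t = t \<longleftrightarrow> t \<le> 0"
      using ex_thompson_line_fixing_half_line by blast
    \<comment> \<open>\<open>?g\<close> preserves the fixed point set \<open>(-\<infinity>,0]\<close> of \<open>u\<close>, hence fixes its end point\<close>
    let ?g = "rat_flow r"
    note g = rat_flow_pl_homeo[of r]
    have "\<Theta> r (unit_conj u) = unit_conj u"
      using r unit_conj_thompson_line[OF u(1)]
      by (simp add: AutoGroup_def BijGroup_def thompson_F_def)
    then have "unit_conj (?g \<circ> u \<circ> inv_into UNIV ?g) = unit_conj u"
      using conj[OF u(1)] unit_conj_thompson_line[OF u(1)] by (simp add: \<Theta>_def)
    then have "?g \<circ> u \<circ> inv_into UNIV ?g = u" by (rule unit_conj_inject)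
    then have comm: "u (?g t) = ?g (u t)" for t
      using g by (metis comp_apply pl_homeo_inv_simps(2))
    have "u (?g 0) = ?g 0" using comm[of 0] u(2)[of 0] by simp
    then have le: "?g 0 \<le> 0" by (simp add: u(2))
    obtain s where s: "?g s = 0" using g by (metis pl_homeo_inv_simps(1))
    have "?g (u s) = ?g s" using comm[of s] s u(2)[of 0] by simp
    then have "u s = s" using g by (metis pl_homeo_inv_simps(2))
    then have "s \<le> 0" by (simp add: u(2))
    then have "?g s \<le> ?g 0" using g by (simp add: pl_homeo_le_iff)
    then have "?g 0 = 0" using s le by simp
    then show ?thesis by (rule rat_flow_fixpoint)
  qed
  define H where "H = \<Theta> ` carrier rat_group"
  have H: "subgroup H (AutoGroup thompson_F)" unfolding H_def by (rule \<Theta>.img_is_subgroup)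
  have "inj_on \<Theta> (carrier rat_group)"
    unfolding \<Theta>.inj_on_one_iff using ker by (simp add: rat_group_def)
  then have "\<Theta> \<in> iso rat_group ((AutoGroup thompson_F)\<lparr>carrier := H\<rparr>)"
    using \<Theta> unfolding iso_def hom_def H_def by (auto simp: bij_betw_def)
  then have "(AutoGroup thompson_F)\<lparr>carrier := H\<rparr> \<cong> rat_group"
    using group.iso_sym[OF group_rat_group is_isoI] by blast
  with H show ?thesis by blast
qed

end
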